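(* Let $V$ satisfy assumptions (A1)--(A2) (stated in the context). Let $E$ be a nonempty relatively compact subset of the open set $$\big\{x\in\overline\Omega:\ 0<T(x)<+\infty,\ \nabla T(x)\ne0\big\}.$$ Then, for each $t\in\mathbb R$ and $x_0\in E$, the matrix $J_{\Phi(t)}(x_0)$ has two positive singular values $$\lambda_{\mathrm{sing}}^{-1}(t,x_0)\in[1,+\infty)\quad\text{and}\quad\lambda_{\mathrm{sing}}(t,x_0)\in(0,1],$$ which satisfy the following, uniformly for $x_0\in E$: $$\lim_{t\to+\infty}\Big[\lambda_{\mathrm{sing}}(t,x_0)\,\big(t\,|\nabla\ln T(x_0)|\,|V(x(t;x_0))|\big)\Big]=1.$$ Moreover, the singular vector $V_{\mathrm{sing}}$ corresponding to $\lambda_{\mathrm{sing}}$ can be chosen such that for some $C=C(\Omega,V,E)>0$, $$|V_{\mathrm{sing}}(t,x_0)-V(x_0)|\le C\big((1+|t|)\,|\nabla\ln T(x_0)|\big)^{-1},\qquad t\in\mathbb R,\ x_0\in E.$$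
   Context: $\Omega\subset\mathbb R^2$ is a bounded Lipschitz domain (open, connected) and $V\in C^1(\overline\Omega;\mathbb R^2)$ (meaning $V$ is $C^1$ on some open set containing $\overline\Omega$) is a time-independent vector field with $\operatorname{div}V=0$ in $\Omega$ and $V\cdot\vec n=0$ on $\partial\Omega$ ($\vec n$ the outward unit normal). Assumptions: (A1) There is $H\in C^2(\mathbb R^2)$ with $V=(\partial_2H,-\partial_1H)^\top$ in $\overline\Omega$ and $H=0$ on $\partial\Omega$. (A2) $H$ has finitely many critical points $x_1^*,\dots,x_K^*$ on $\overline\Omega$, and for each $k$ there are a real number $m_k\ge1$ and a symmetric nonsingular $S_k\in\mathbb R^{2\times2}$ such that $H(x_k^*+y)-H(x_k^* )=\frac12|y|^{m_k-1}y^\top S_ky+R_k(y)$ for $y$ near $0$, where $R_k\in C^2(\mathbb R^2)$ and $\|D^jR_k(y)\|=o(|y|^{m_k+1-j})$ as $y\to0$, $j=0,1,2$. Flow: for $x_0\in\overline\Omega$, $x(\cdot;x_0)$ solves $x'(t)=V(x(t))$, $t\in\mathbb R$, $x(0)=x_0$, and $\Phi(t)(x_0):=x(t;x_0)$ (a $C^1$ map); $J_{\Phi(t)}(x_0)$ is its Jacobian matrix with respect to $x_0$. Orbit period: $T(x_0):=\inf\{\hat t>0: x(\hat t;x_0)=x_0\}\in[0,+\infty]$ for $x_0\in\overline\Omega$, with $T(x_0)=+\infty$ if the set is empty. $T$ is $C^1$ on the set $\{0<T<+\infty\}$. "Open" and "relatively compact" are relative to $\overline\Omega$: $E$ has compact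 closure contained in the displayed set. Singular vector means right singular vector (not normalized): a nonzero vector with $J_{\Phi(t)}(x_0)^\top J_{\Phi(t)}(x_0)V_{\mathrm{sing}}=\lambda_{\mathrm{sing}}^2V_{\mathrm{sing}}$. *)

theory Defs
  imports "HOL-Analysis.Analysis" "HOL-Library.Landau_Symbols"
begin

section \<open>Differential calculus\<close>

definition C1_on :: "('a::real_normed_vector \<Rightarrow> 'b::real_normed_vector) \<Rightarrow> 'a set \<Rightarrow> bool" where
  "C1_on f U \<longleftrightarrow>
     (\<exists>f' :: 'a \<Rightarrow> 'a \<Rightarrow>\<^sub>L 'b.
        (\<forall>x\<in>U. (f has_derivative blinfun_apply (f' x)) (at x)) \<and> continuous_on U f')"

text \<open>\<open>C2_derivs f f' f'' U\<close>: on \<open>U\<close>, \<open>f\<close> is of class $C^2$ with first and second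
  derivatives \<open>f'\<close> and \<open>f''\<close>.\<close>

definition C2_derivs ::
  "('a::real_normed_vector \<Rightarrow> 'b::real_normed_vector) \<Rightarrow> ('a \<Rightarrow> 'a \<Rightarrow>\<^sub>L 'b) \<Rightarrow>
   ('a \<Rightarrow> 'a \<Rightarrow>\<^sub>L 'a \<Rightarrow>\<^sub>L 'b) \<Rightarrow> 'a set \<Rightarrow> bool" where
  "C2_derivs f f' f'' U \<longleftrightarrow>
     (\<forall>x\<in>U. (f has_derivative blinfun_apply (f' x)) (at x)) \<and>
     (\<forall>x\<in>U. (f' has_derivative blinfun_apply (f'' x)) (at x)) \<and>
     continuous_on U f''"

definition C2_on :: "('a::real_normed_vector \<Rightarrow> 'b::real_normed_vector) \<Rightarrow> 'a set \<Rightarrow> bool" where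
  "C2_on f U \<longleftrightarrow> (\<exists>f' f''. C2_derivs f f' f'' U)"

text \<open>The filter is a parameter because functions such as the orbit period live on the closed set
  \<open>closure \<Omega>\<close> only, and are differentiated at its points with the filter
  \<open>at x within closure \<Omega>\<close>.\<close>

definition grad :: "(real^'n \<Rightarrow> real) \<Rightarrow> (real^'n) filter \<Rightarrow> real^'n" where
  "grad f F = (\<chi> i. frechet_derivative f F (axis i 1))"

definition divergence :: "(real^'n \<Rightarrow> real^'n) \<Rightarrow> real^'n \<Rightarrow> real" where
  "divergence V x = trace (jacobian V (at x))"


section \<open>Planar Lipschitz domains\<close>

text \<open>After the rigid motion \<open>y \<mapsto> p + Q y\<close>, the domain is near \<open>p\<close> the strict epigraph of the
  Lipschitz function \<open>\<gamma>\<close>, so that its boundary near \<open>p\<close> is the graph of \<open>\<gamma>\<close>.\<close>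

definition lipschitz_chart ::
  "(real^2) set \<Rightarrow> real^2 \<Rightarrow> (real^2 \<Rightarrow> real^2) \<Rightarrow> (real \<Rightarrow> real) \<Rightarrow> bool" where
  "lipschitz_chart \<Omega> p Q \<gamma> \<longleftrightarrow>
     orthogonal_transformation Q \<and> \<gamma> 0 = 0 \<and>
     (\<exists>r>0. \<exists>h>0.
        (\<exists>L. L-lipschitz_on {-r<..<r} \<gamma>) \<and>
        (\<forall>s. \<bar>s\<bar> < r \<longrightarrow> \<bar>\<gamma> s\<bar> < h) \<and>
        (\<forall>s u. \<bar>s\<bar> < r \<longrightarrow> \<bar>u\<bar> < h \<longrightarrow> (p + Q (vector [s, u]) \<in> \<Omega> \<longleftrightarrow> \<gamma> s < u)))"

definition lipschitz_domain :: "(real^2) set \<Rightarrow> bool" where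
  "lipschitz_domain \<Omega> \<longleftrightarrow>
     open \<Omega> \<and> connected \<Omega> \<and> (\<forall>p\<in>frontier \<Omega>. \<exists>Q \<gamma>. lipschitz_chart \<Omega> p Q \<gamma>)"

text \<open>The normal exists at those boundary points where the boundary graph is differentiable,
  hence at almost every boundary point.\<close>

definition outward_unit_normal :: "(real^2) set \<Rightarrow> real^2 \<Rightarrow> real^2 \<Rightarrow> bool" where
  "outward_unit_normal \<Omega> p n \<longleftrightarrow>
     p \<in> frontier \<Omega> \<and>
     (\<exists>Q \<gamma> d. lipschitz_chart \<Omega> p Q \<gamma> \<and> (\<gamma> has_real_derivative d) (at 0) \<and>
        n = (1 / sqrt (1 + d\<^sup>2)) *\<^sub>R Q (vector [d, -1]))"


section \<open>Divergence-free fields and their stream functions\<close>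

definition admissible_field :: "(real^2) set \<Rightarrow> (real^2 \<Rightarrow> real^2) \<Rightarrow> bool" where
  "admissible_field \<Omega> V \<longleftrightarrow>
     (\<exists>U. open U \<and> closure \<Omega> \<subseteq> U \<and> C1_on V U) \<and>
     (\<forall>x\<in>\<Omega>. divergence V x = 0) \<and>
     (\<forall>p n. outward_unit_normal \<Omega> p n \<longrightarrow> V p \<bullet> n = 0)"

definition stream_function ::
  "(real^2) set \<Rightarrow> (real^2 \<Rightarrow> real^2) \<Rightarrow> (real^2 \<Rightarrow> real) \<Rightarrow> bool" where
  "stream_function \<Omega> V H \<longleftrightarrow>
     C2_on H UNIV \<and>
     (\<forall>x\<in>closure \<Omega>. V x = vector [grad H (at x) $ 2, - grad H (at x) $ 1]) \<and>
     (\<forall>x\<in>frontier \<Omega>. H x = 0)"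

text \<open>The remainder bounds are relative to \<open>at 0\<close>, so that the value of \<open>0 powr (m - 1)\<close> is
  irrelevant; \<open>norm (R' y)\<close> and \<open>norm (R'' y)\<close> are operator norms.\<close>

definition homogeneous_critical_point :: "(real^2 \<Rightarrow> real) \<Rightarrow> real^2 \<Rightarrow> bool" where
  "homogeneous_critical_point H p \<longleftrightarrow>
     (\<exists>(m::real) (S::real^2^2) R R' R''.
        1 \<le> m \<and> transpose S = S \<and> invertible S \<and>
        (\<forall>\<^sub>F y in nhds 0.
           H (p + y) - H p = 1/2 * norm y powr (m - 1) * (y \<bullet> (S *v y)) + R y) \<and>
        C2_derivs R R' R'' UNIV \<and>
        R \<in> o[at 0](\<lambda>y. norm y powr (m + 1)) \<and>
        (\<lambda>y. norm (R' y)) \<in> o[at 0](\<lambda>y. norm y powr m) \<and>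
        (\<lambda>y. norm (R'' y)) \<in> o[at 0](\<lambda>y. norm y powr (m - 1)))"

definition critical_points_condition :: "(real^2) set \<Rightarrow> (real^2 \<Rightarrow> real) \<Rightarrow> bool" where
  "critical_points_condition \<Omega> H \<longleftrightarrow>
     finite {p \<in> closure \<Omega>. grad H (at p) = 0} \<and>
     (\<forall>p\<in>closure \<Omega>. grad H (at p) = 0 \<longrightarrow> homogeneous_critical_point H p)"


section \<open>Flow and orbit period\<close>

text \<open>\<open>\<Phi> t x\<close> is the position at time \<open>t\<close> of the trajectory starting at \<open>x \<in> D\<close>; the values of
  \<open>\<Phi> t\<close> outside \<open>D\<close> are unconstrained.\<close>

definition is_flow ::
  "('a::real_normed_vector \<Rightarrow> 'a) \<Rightarrow> 'a set \<Rightarrow> (real \<Rightarrow> 'a \<Rightarrow> 'a) \<Rightarrow> bool" where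
  "is_flow V D \<Phi> \<longleftrightarrow>
     (\<forall>x\<in>D. \<Phi> 0 x = x \<and>
        (\<forall>t. \<Phi> t x \<in> D \<and> ((\<lambda>s. \<Phi> s x) has_vector_derivative V (\<Phi> t x)) (at t)))"

definition orbit_period :: "(real \<Rightarrow> 'a \<Rightarrow> 'a) \<Rightarrow> 'a \<Rightarrow> ereal" where
  "orbit_period \<Phi> x = Inf (ereal ` {t. 0 < t \<and> \<Phi> t x = x})"

definition shear_set :: "(real^2) set \<Rightarrow> (real \<Rightarrow> real^2 \<Rightarrow> real^2) \<Rightarrow> (real^2) set" where
  "shear_set \<Omega> \<Phi> =
     {x \<in> closure \<Omega>. 0 < orbit_period \<Phi> x \<and> orbit_period \<Phi> x < \<infinity> \<and>
        grad (\<lambda>y. real_of_ereal (orbit_period \<Phi> y)) (at x within closure \<Omega>) \<noteq> 0}"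

definition grad_ln_period ::
  "(real^2) set \<Rightarrow> (real \<Rightarrow> real^2 \<Rightarrow> real^2) \<Rightarrow> real^2 \<Rightarrow> real^2" where
  "grad_ln_period \<Omega> \<Phi> x =
     grad (\<lambda>y. ln (real_of_ereal (orbit_period \<Phi> y))) (at x within closure \<Omega>)"

definition flow_jacobian ::
  "(real^2) set \<Rightarrow> (real \<Rightarrow> real^2 \<Rightarrow> real^2) \<Rightarrow> real \<Rightarrow> real^2 \<Rightarrow> real^2^2" where
  "flow_jacobian \<Omega> \<Phi> t x = jacobian (\<Phi> t) (at x within closure \<Omega>)"


section \<open>Singular values\<close>

text \<open>\<open>M\<close> lists the singular values of \<open>A\<close>, i.e. the nonnegative square roots of the eigenvalues
  of \<open>transpose A ** A\<close>. Multiplicities are eigenspace dimensions, which is the same as algebraic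
  multiplicities because the matrix is symmetric.\<close>

definition has_singular_values :: "real^'n^'n \<Rightarrow> real multiset \<Rightarrow> bool" where
  "has_singular_values A M \<longleftrightarrow>
     (\<forall>\<sigma>. count M \<sigma> =
        (if 0 \<le> \<sigma> then dim {v. (transpose A ** A) *v v = \<sigma>\<^sup>2 *\<^sub>R v} else 0))"

definition right_singular_vector :: "real^'n^'n \<Rightarrow> real \<Rightarrow> real^'n \<Rightarrow> bool" where
  "right_singular_vector A \<sigma> v \<longleftrightarrow> v \<noteq> 0 \<and> (transpose A ** A) *v v = \<sigma>\<^sup>2 *\<^sub>R v"

end

(*
  The linearised flow can be integrated by hand. Along an orbit, p(t) = V(x(t)) solves the linearised
  equation, and since div V = 0, reduction of order gives a second solution a(t) p(t) + J p(t) / |p(t)|^2,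
  where J is the rotation by a right angle and a(t) the integral of a continuous function along the
  orbit. So in the normalised frames (p(0), J p(0)) and (p(t), J p(t)) the Jacobian of the flow is upper
  triangular with determinant 1 and off-diagonal entry |p(0)| |p(t)| a(t). Differentiating
  x(T(x); x) = x gives grad T = - a(T) J p(0), and a(t + T) = a(t) + a(T), whence a(t) = t a(T) / T + O(1)
  and the off-diagonal entry is t |grad ln T| |V(x(t))| up to a bounded error and sign.
  A unimodular matrix with large Frobenius norm F has singular values close to F and 1/F. Finally, the
  component of p(0) along the other singular vector has length at most lambda |p(t)|, because the
  Jacobian maps p(0) to p(t); so V_sing can be the projection of V(x) to the singular line.
*)
theory Submission
  imports Defs
begin

section \<open>Singular values of planar unimodular matrices\<close>

text \<open>The flow lives only on the closed set \<open>closure \<Omega>\<close>, which need not be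
  convex, and an orbit in question may run along the boundary. Three obstacles follow. Mean value
  estimates for V hold only at short distance, in a neighbourhood where V is of class C^1. Gradients
  and Jacobians relative to \<open>closure \<Omega>\<close> are picked by a choice operator, so they
  mean something only once derivatives within a Lipschitz domain are shown to be unique. And the
  flow map and the period are differentiated by direct estimates relative to
  \<open>closure \<Omega>\<close>, without an implicit function theorem. Differentiating x(T(x); x)
  = x presupposes that orbits near a periodic one close up after nearly the same time. The stream
  function gives this: a nearby orbit crosses a line transverse to V again, and H, constant on the
  orbit and strictly monotone on that line, identifies the crossing with the starting point.
  Uniformity comes from compactness: the orbits through the closure of E fill a compact set where V
  has no zero, and a(T) / T is continuous and nonzero on that closure.\<close>

definition rot :: "real^2 \<Rightarrow> real^2" where
  "rot v = vector [- v $ 2, v $ 1]"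

lemma rot_nth [simp]: "rot v $ 1 = - v $ 2" "rot v $ 2 = v $ 1"
  by (simp_all add: rot_def)

lemma inner_real2: "(v::real^2) \<bullet> w = v $ 1 * w $ 1 + v $ 2 * w $ 2"
  by (simp add: inner_vec_def sum_2)

lemma bounded_linear_rot: "bounded_linear rot"
  by (rule linear_conv_bounded_linear[THEN iffD1], rule linearI)
     (simp_all add: vec_eq_iff forall_2)

lemmas rot_linear [simp] =
  bounded_linear.linear[OF bounded_linear_rot, THEN linear_add]
  bounded_linear.linear[OF bounded_linear_rot, THEN linear_diff]
  bounded_linear.linear[OF bounded_linear_rot, THEN linear_scale]

lemma rot_inner [simp]:
  "v \<bullet> rot v = 0" "rot v \<bullet> v = 0" "rot v \<bullet> rot w = v \<bullet> w"
  by (simp_all add: inner_real2)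

lemma norm_rot [simp]: "norm (rot v) = norm v"
  by (simp add: norm_eq_sqrt_inner)

text \<open>\<open>p\<close> and \<open>rot p\<close> are orthogonal of equal length; the factor
  \<open>(norm p)\<^sup>2\<close> keeps the expansion valid at p = 0.\<close>

lemma inner_rot_decompose:
  "(norm p)\<^sup>2 *\<^sub>R h = (h \<bullet> p) *\<^sub>R p + (h \<bullet> rot p) *\<^sub>R rot p"
  by (simp add: vec_eq_iff forall_2 inner_real2 power2_norm_eq_inner) (simp add: algebra_simps)

text \<open>The trace may be taken in the orthogonal frame \<open>p\<close>, \<open>rot p\<close>.
  This is the form in which div V = 0 is used.\<close>

lemma rot_inner_trace:
  assumes "linear A"
  shows "rot p \<bullet> A (rot p) + p \<bullet> A p = (norm p)\<^sup>2 * trace (matrix A)"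
proof -
  define M where "M = matrix A"
  have A: "A v = M *v v" for v
    using assms by (simp add: M_def)
  show ?thesis
    unfolding A M_def[symmetric] power2_norm_eq_inner inner_real2 trace_def sum_2
      matrix_vector_mult_def by simp algebra
qed

text \<open>\<open>rot a \<bullet> b\<close> is the determinant with columns a and b, so this is
  multiplicativity of signed area.\<close>

lemma rot_inner_matrix:
  fixes M :: "real^2^2"
  shows "rot (M *v a) \<bullet> (M *v b) = det M * (rot a \<bullet> b)"
  by (simp add: inner_real2 matrix_vector_mult_def sum_2 det_2) (simp add: algebra_simps)

text \<open>The square of the Frobenius norm, hence the sum of the squared singular values.\<close>

definition frob :: "real^2^2 \<Rightarrow> real" where
  "frob M = trace (transpose M ** M)"

text \<open>For determinant 1 the eigenvalues of the Gram matrix have sum \<open>frob M\<close> and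
  product 1; the radicand is the smaller root of the resulting quadratic.\<close>

definition least_sv :: "real^2^2 \<Rightarrow> real" where
  "least_sv M = sqrt ((frob M - sqrt ((frob M)\<^sup>2 - 4)) / 2)"

lemma frob_eq: "frob M = (M$1$1)\<^sup>2 + (M$1$2)\<^sup>2 + (M$2$1)\<^sup>2 + (M$2$2)\<^sup>2"
  by (simp add: frob_def trace_def matrix_matrix_mult_def transpose_def sum_2 power2_eq_square)

text \<open>Makes that quadratic have real roots: \<open>frob M\<close> exceeds twice the
  determinant by a sum of two squares.\<close>

lemma frob_ge_2:
  assumes "det M = 1"
  shows "2 \<le> frob M"
proof -
  have "frob M = (M$1$1 - M$2$2)\<^sup>2 + (M$1$2 + M$2$1)\<^sup>2 + 2 * det M"
    by (simp add: frob_eq det_2 power2_eq_square) (simp add: algebra_simps)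
  then show ?thesis
    using assms by simp
qed

text \<open>The root equation is stated without division; later estimates use only these three facts
  and never the closed formula.\<close>

lemma least_sv:
  assumes "det M = 1"
  shows least_sv_pos: "0 < least_sv M" and least_sv_le_1: "least_sv M \<le> 1"
    and least_sv_root: "(least_sv M)\<^sup>2 * frob M = 1 + (least_sv M) ^ 4"
proof -
  define S where "S = frob M"
  define q where "q = sqrt (S\<^sup>2 - 4)"
  define \<mu> where "\<mu> = (S - q) / 2"
  have S2: "2 \<le> S" using frob_ge_2[OF assms] by (simp add: S_def)
  have "2\<^sup>2 \<le> S\<^sup>2" using S2 by (intro power_mono) auto
  then have q2: "q\<^sup>2 = S\<^sup>2 - 4" and q0: "0 \<le> q" by (simp_all add: q_def)
  have "q\<^sup>2 < S\<^sup>2" unfolding q2 by simp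
  moreover have "0 \<le> S" using S2 by simp
  ultimately have "q < S" by (rule power2_less_imp_less)
  then have mu0: "0 < \<mu>" by (simp add: \<mu>_def)
  have "(S - 2)\<^sup>2 \<le> q\<^sup>2" using S2 by (simp add: q2 power2_diff)
  then have "S - 2 \<le> q" using q0 by (rule power2_le_imp_le)
  then have mu1: "\<mu> \<le> 1" by (simp add: \<mu>_def)
  have root: "\<mu> * S = 1 + \<mu>\<^sup>2"
    using q2 by (simp add: \<mu>_def power2_eq_square) (simp add: field_simps)
  have ls: "least_sv M = sqrt \<mu>"
    by (simp add: least_sv_def \<mu>_def q_def S_def)
  show "0 < least_sv M" "least_sv M \<le> 1" using mu0 mu1 by (simp_all add: ls)
  have "(least_sv M)\<^sup>2 = \<mu>" using mu0 by (simp add: ls)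
  moreover from this have "(least_sv M) ^ 4 = \<mu>\<^sup>2"
    by (metis mult_2 numeral_Bit0 power2_eq_square power_add)
  ultimately show "(least_sv M)\<^sup>2 * frob M = 1 + (least_sv M) ^ 4"
    using root by (simp add: S_def)
qed

lemma det_gram_shift:
  assumes "det (M::real^2^2) = 1"
  shows "det (transpose M ** M - mat \<mu>) = \<mu>\<^sup>2 - frob M * \<mu> + 1"
proof -
  have "det (transpose M ** M - mat \<mu>) = \<mu>\<^sup>2 - frob M * \<mu> + (det M)\<^sup>2"
    by (simp add: det_2 frob_eq matrix_matrix_mult_def transpose_def sum_2 mat_def) algebra
  then show ?thesis using assms by simp
qed

lemma eigenvector_shift:
  fixes A :: "real^2^2"
  shows "A *v v = \<mu> *\<^sub>R v \<longleftrightarrow> (A - mat \<mu>) *v v = 0"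
proof -
  have "mat \<mu> *v v = \<mu> *\<^sub>R v"
    by (simp add: vec_eq_iff forall_2 matrix_vector_mult_def sum_2 mat_def)
  then show ?thesis
    by (simp add: matrix_vector_mult_diff_rdistrib)
qed

text \<open>In the plane it is enough to know whether the dimension is 0 and whether it is 2.
  Multiplicities of singular values are counted through this.\<close>

lemma dim_kernel_2:
  fixes B :: "real^2^2"
  shows "dim {v. B *v v = 0} = (if det B \<noteq> 0 then 0 else if B = 0 then 2 else 1)"
proof -
  let ?K = "{v. B *v v = 0}"
  have le: "dim ?K \<le> 2" using dim_subset_UNIV_cart[of ?K] by simp
  have sub: "subspace ?K"
    by (simp add: subspace_def matrix_vector_right_distrib matrix_vector_mult_scaleR)
  have 0: "dim ?K = 0 \<longleftrightarrow> det B \<noteq> 0"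
  proof -
    have "dim ?K = 0 \<longleftrightarrow> (\<forall>v. B *v v = 0 \<longrightarrow> v = 0)"
      unfolding dim_eq_0 by blast
    also have "\<dots> \<longleftrightarrow> det B \<noteq> 0"
      unfolding invertible_det_nz[symmetric] invertible_left_inverse matrix_left_invertible_ker ..
    finally show ?thesis .
  qed
  have 2: "dim ?K = 2 \<longleftrightarrow> B = 0"
  proof
    assume "dim ?K = 2"
    then have "?K = UNIV"
      using dim_eq_full[of ?K] span_eq_iff[THEN iffD2, OF sub] by simp
    then have "\<forall>v. B *v v = 0 *v v" by auto
    then show "B = 0" unfolding matrix_eq .
  next
    assume "B = 0"
    then show "dim ?K = 2" by simp
  qed
  have "k = (if \<not> z then 0 else if t then 2 else 1)"
    if "k \<le> 2" "k = 0 \<longleftrightarrow> \<not> z" "k = 2 \<longleftrightarrow> t" for k :: nat and z t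
    using that by (auto split: if_splits)
  from this[OF le 0 2] show ?thesis .
qed

text \<open>The case of a double singular value, in which M is a rotation: a scalar Gram matrix has
  determinant \<open>\<mu>\<^sup>2\<close>, which must be 1.\<close>

lemma gram_eq_mat:
  assumes "det (M::real^2^2) = 1"
  shows "transpose M ** M = mat \<mu> \<longleftrightarrow> \<mu> = 1 \<and> frob M = 2"
proof
  assume A: "transpose M ** M = mat \<mu>"
  then have f: "frob M = 2 * \<mu>" by (simp add: frob_def trace_def mat_def sum_2)
  have "det (transpose M ** M) = \<mu>\<^sup>2" by (simp add: A det_2 mat_def power2_eq_square)
  then have "\<mu>\<^sup>2 = 1" by (simp add: det_mul assms)
  moreover have "0 \<le> \<mu>" using f frob_ge_2[OF assms] by simp
  ultimately have "\<mu> = 1" by (simp add: power2_eq_1_iff)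
  then show "\<mu> = 1 \<and> frob M = 2" using f by simp
next
  assume R: "\<mu> = 1 \<and> frob M = 2"
  have "frob M = (M$1$1 - M$2$2)\<^sup>2 + (M$1$2 + M$2$1)\<^sup>2 + 2 * det M"
    by (simp add: frob_eq det_2 power2_eq_square) (simp add: algebra_simps)
  then have "(M$1$1 - M$2$2)\<^sup>2 + (M$1$2 + M$2$1)\<^sup>2 = 0" using R assms by simp
  then have e: "M$1$1 = M$2$2" "M$2$1 = - M$1$2" by (auto simp: sum_power2_eq_zero_iff)
  then have "M$2$2 * M$2$2 + M$1$2 * M$1$2 = 1" using assms by (simp add: det_2)
  moreover have "\<mu> = 1" using R ..
  ultimately show "transpose M ** M = mat \<mu>"
    by (simp add: vec_eq_iff forall_2 matrix_matrix_mult_def transpose_def sum_2 mat_def e)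
qed

lemma has_singular_values_unimodular:
  assumes M: "det (M::real^2^2) = 1"
  shows "has_singular_values M {# inverse (least_sv M), least_sv M #}"
  unfolding has_singular_values_def
proof
  fix \<sigma> :: real
  let ?l = "least_sv M"
  note l = least_sv[OF M]
  show "count {# inverse ?l, ?l #} \<sigma>
    = (if 0 \<le> \<sigma> then dim {v. (transpose M ** M) *v v = \<sigma>\<^sup>2 *\<^sub>R v} else 0)"
  proof (cases "0 \<le> \<sigma>")
    case False
    then show ?thesis using l(1) by (auto simp: count_eq_zero_iff)
  next
    case True
    define B where "B = transpose M ** M - mat (\<sigma>\<^sup>2)"
    have K: "{v. (transpose M ** M) *v v = \<sigma>\<^sup>2 *\<^sub>R v} = {v. B *v v = 0}"
      unfolding B_def eigenvector_shift ..
    \<comment> \<open>The factor \<open>?l\<^sup>2\<close> clears the denominator in the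
      factorisation of the characteristic polynomial over its roots \<open>?l\<^sup>2\<close> and
      \<open>1 / ?l\<^sup>2\<close>.\<close>
    have "?l\<^sup>2 * det B = (\<sigma>\<^sup>2 - ?l\<^sup>2) * (?l\<^sup>2 * \<sigma>\<^sup>2 - 1)"
    proof -
      have "?l\<^sup>2 * det B = ?l\<^sup>2 * \<sigma>\<^sup>2 * \<sigma>\<^sup>2 - (?l\<^sup>2 * frob M) * \<sigma>\<^sup>2 + ?l\<^sup>2"
        unfolding B_def det_gram_shift[OF M] by (simp add: algebra_simps power2_eq_square)
      then show ?thesis unfolding l(3) by (simp add: algebra_simps power4_eq_xxxx power2_eq_square)
    qed
    then have "det B = 0 \<longleftrightarrow> \<sigma>\<^sup>2 = ?l\<^sup>2 \<or> ?l\<^sup>2 * \<sigma>\<^sup>2 = 1" using l(1)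
      by (metis eq_iff_diff_eq_0 less_irrefl mult_eq_0_iff zero_less_power)
    also have "\<dots> \<longleftrightarrow> \<sigma> = ?l \<or> ?l * \<sigma> = 1"
    proof -
      have "0 \<le> ?l * \<sigma>" using True l(1) by simp
      then have "?l\<^sup>2 * \<sigma>\<^sup>2 = 1 \<longleftrightarrow> ?l * \<sigma> = 1"
        unfolding power_mult_distrib[symmetric] power2_eq_1_iff by linarith
      then show ?thesis using True l(1) by (simp add: power2_eq_iff_nonneg)
    qed
    also have "\<dots> \<longleftrightarrow> \<sigma> = ?l \<or> \<sigma> = inverse ?l"
      using l(1) by (auto simp: field_simps)
    finally have det: "det B = 0 \<longleftrightarrow> \<sigma> = ?l \<or> \<sigma> = inverse ?l" .
    have "?l = 1 \<longleftrightarrow> frob M = 2"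
    proof
      assume "frob M = 2"
      moreover have "(?l\<^sup>2 - 1)\<^sup>2 = 1 + ?l ^ 4 - ?l\<^sup>2 * 2"
        by (simp add: power2_diff flip: power_mult)
      ultimately have "?l\<^sup>2 = 1" using l(3) by simp
      then show "?l = 1" using l(1) by (simp add: power2_eq_1_iff)
    qed (use l(3) in simp)
    moreover have "B = 0 \<longleftrightarrow> \<sigma>\<^sup>2 = 1 \<and> frob M = 2"
      unfolding B_def using gram_eq_mat[OF M] by simp
    ultimately have zero: "B = 0 \<longleftrightarrow> \<sigma> = 1 \<and> ?l = 1"
      using True by (auto simp: power2_eq_1_iff)
    define i where "i = inverse ?l"
    have li: "?l = i \<longleftrightarrow> ?l = 1" unfolding i_def
      using one_less_inverse[OF l(1)] l(2) by (cases "?l = 1") auto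
    have count: "count {# i, ?l #} \<sigma> = (if \<sigma> = i then 1 else 0) + (if \<sigma> = ?l then 1 else 0)"
      by simp
    \<comment> \<open>If both values coincide they equal 1, and the multiset counts 1 twice, in
      agreement with an eigenspace that is the whole plane.\<close>
    have "(if \<sigma> = i then 1 else 0) + (if \<sigma> = ?l then 1 else 0) =
      (if \<not> (\<sigma> = ?l \<or> \<sigma> = i) then 0 else if \<sigma> = 1 \<and> ?l = 1 then 2 else (1::nat))"
    proof (cases "?l = 1")
      case True
      with li show ?thesis by simp
    next
      case False
      with li have "?l \<noteq> i" by simp
      with False show ?thesis by simp
    qed
    also have "\<dots> = dim {v. (transpose M ** M) *v v = \<sigma>\<^sup>2 *\<^sub>R v}"
      unfolding K dim_kernel_2 det zero i_def by (rule if_cong) simp_all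
    finally show ?thesis
      unfolding i_def[symmetric] count if_P[OF True] .
  qed
qed

text \<open>M maps the unit singular vector w and its normal u to orthogonal vectors, of length l
  and at least 1 / l. So the u-component of p contributes at least
  \<open>\<bar>p \<bullet> u\<bar> / l\<close> to the length of \<open>M *v p\<close>, and the
  projection of p to the line of w lies within \<open>norm (M *v p) * l\<close> of p.\<close>

lemma singular_vector_near:
  assumes M: "det (M::real^2^2) = 1" and p: "p \<noteq> 0"
  shows "\<exists>v. right_singular_vector M (least_sv M) v \<and>
    norm (v - p) \<le> (1 + 1 / norm p) * norm (M *v p) * least_sv M"
proof -
  let ?l = "least_sv M"
  note l = least_sv[OF M]
  have "det (transpose M ** M - mat (?l\<^sup>2)) = 0"
    unfolding det_gram_shift[OF M] mult.commute[of "frob M"] l(3) by (simp flip: power_mult)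
  then have "dim {v. (transpose M ** M - mat (?l\<^sup>2)) *v v = 0} \<noteq> 0"
    unfolding dim_kernel_2 by simp
  then obtain w0 where w0: "w0 \<noteq> 0" "(transpose M ** M) *v w0 = ?l\<^sup>2 *\<^sub>R w0"
    unfolding dim_eq_0 eigenvector_shift by auto
  define w where "w = (1 / norm w0) *\<^sub>R w0"
  have w: "norm w = 1" "(transpose M ** M) *v w = ?l\<^sup>2 *\<^sub>R w"
    using w0 by (simp_all add: w_def matrix_vector_mult_scaleR)
  have sv: "right_singular_vector M ?l (c *\<^sub>R w)" if "c \<noteq> 0" for c
    using w that by (auto simp: right_singular_vector_def matrix_vector_mult_scaleR)
  define u where "u = rot w"
  have gram: "(M *v a) \<bullet> (M *v b) = ((transpose M ** M) *v a) \<bullet> b" for a b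
    by (simp only: matrix_vector_mul_assoc[symmetric] transpose_matrix_vector dot_lmul_matrix)
  have Mw: "norm (M *v w) = ?l"
    using gram[of w w] w l(1) by (simp add: norm_eq_sqrt_inner)
  have orth: "(M *v w) \<bullet> (M *v u) = 0"
    unfolding gram w(2) by (simp add: u_def)
  have ww: "w \<bullet> w = 1" using w(1) by (simp add: norm_eq_1)
  \<comment> \<open>M preserves the area 1 of the square on w and u, so shrinking w to length l
    forces u to grow.\<close>
  have "rot (M *v w) \<bullet> (M *v u) = 1"
    unfolding rot_inner_matrix M u_def using ww by simp
  then have Mu: "1 \<le> ?l * norm (M *v u)"
    using norm_cauchy_schwarz[of "rot (M *v w)" "M *v u"] Mw by simp
  have pdec: "p = (p \<bullet> w) *\<^sub>R w + (p \<bullet> u) *\<^sub>R u"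
    using inner_rot_decompose[of w p] w(1) by (simp add: u_def)
  have Mp: "M *v p = (p \<bullet> w) *\<^sub>R (M *v w) + (p \<bullet> u) *\<^sub>R (M *v u)"
    by (subst pdec) (simp add: matrix_vector_right_distrib matrix_vector_mult_scaleR)
  have "(norm ((p \<bullet> u) *\<^sub>R (M *v u)))\<^sup>2 \<le> (norm (M *v p))\<^sup>2"
    unfolding Mp using norm_add_Pythagorean[of "(p \<bullet> w) *\<^sub>R (M *v w)" "(p \<bullet> u) *\<^sub>R (M *v u)"]
    by (simp add: orthogonal_def orth del: norm_scaleR)
  then have "norm ((p \<bullet> u) *\<^sub>R (M *v u)) \<le> norm (M *v p)"
    by (rule power2_le_imp_le) simp
  then have "\<bar>p \<bullet> u\<bar> * norm (M *v u) \<le> norm (M *v p)"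
    by simp
  then have "\<bar>p \<bullet> u\<bar> * (?l * norm (M *v u)) \<le> ?l * norm (M *v p)"
    using l(1) by (simp add: mult.left_commute)
  then have pu: "\<bar>p \<bullet> u\<bar> \<le> norm (M *v p) * ?l"
    using Mu mult_left_mono[OF Mu, of "\<bar>p \<bullet> u\<bar>"] by (simp add: mult.commute)
  have nu: "norm u = 1" by (simp add: u_def w)
  have n1: "norm ((p \<bullet> w) *\<^sub>R w - p) = \<bar>p \<bullet> u\<bar>"
  proof -
    have "(p \<bullet> w) *\<^sub>R w - p = - ((p \<bullet> u) *\<^sub>R u)"
      using pdec by (metis add_diff_cancel_left' minus_diff_eq)
    then show ?thesis by (simp add: nu)
  qed
  show ?thesis
  proof (cases "p \<bullet> w = 0")
    case False
    have "norm ((p \<bullet> w) *\<^sub>R w - p) \<le> norm (M *v p) * ?l" using n1 pu by simp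
    also have "\<dots> \<le> (1 + 1 / norm p) * (norm (M *v p) * ?l)"
      using l(1) by (simp add: distrib_right)
    finally show ?thesis using sv[OF False] by (auto simp: mult.assoc)
  next
    \<comment> \<open>The projection vanishes and is no singular vector, so w itself serves. Now p
      is a multiple of u, and its length is at most \<open>norm (M *v p) * ?l\<close>; the summand
      \<open>1 / norm p\<close> in the bound pays for the unit length of w.\<close>
    case True
    then have np: "norm p \<le> norm (M *v p) * ?l" using n1 pu by simp
    have "norm (w - p) \<le> 1 + norm p" using norm_triangle_ineq4[of w p] w(1) by simp
    also have "\<dots> = (1 + 1 / norm p) * norm p" using p by (simp add: field_simps)
    also have "\<dots> \<le> (1 + 1 / norm p) * (norm (M *v p) * ?l)"
      using np by (intro mult_left_mono) auto
    finally show ?thesis using sv[of 1] by (auto simp: mult.assoc)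
  qed
qed

section \<open>Derivatives within a Lipschitz domain\<close>

text \<open>Restriction to the ray leaves a function of one variable, whose one-sided derivative is
  unique.\<close>

lemma has_derivative_ray_unique:
  fixes f :: "'a::real_normed_vector \<Rightarrow> 'b::real_normed_vector"
  assumes f1: "(f has_derivative f1) (at x within S)" and f2: "(f has_derivative f2) (at x within S)"
    and r: "0 < r" and ray: "\<And>t. 0 \<le> t \<Longrightarrow> t < r \<Longrightarrow> x + t *\<^sub>R v \<in> S"
  shows "f1 v = f2 v"
proof -
  have "((\<lambda>t. f (x + t *\<^sub>R v)) has_vector_derivative g v) (at 0 within {0..<r})"
    if "(f has_derivative g) (at x within S)" for g
  proof -
    have "((\<lambda>t. x + t *\<^sub>R v) has_derivative (\<lambda>t. t *\<^sub>R v)) (at 0 within {0..<r})"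
      by (auto intro!: derivative_eq_intros)
    moreover have "(f has_derivative g) (at (x + 0 *\<^sub>R v) within (\<lambda>t. x + t *\<^sub>R v) ` {0..<r})"
      using ray by (auto intro: has_derivative_subset[OF that])
    ultimately have "((\<lambda>t. f (x + t *\<^sub>R v)) has_derivative (\<lambda>t. g (t *\<^sub>R v))) (at 0 within {0..<r})"
      by (rule has_derivative_in_compose)
    moreover have "linear g" using that by (rule has_derivative_linear)
    ultimately show ?thesis
      by (simp add: has_vector_derivative_def linear_scale)
  qed
  note this[OF f1] this[OF f2]
  moreover have "at 0 within {0..<r} \<noteq> bot"
    using r by (auto simp: trivial_limit_within intro!: islimpt_subset[of 0 "{0<..<r}"] islimpt_greaterThanLessThan1)
  ultimately show ?thesis by (intro vector_derivative_unique_within) auto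
qed

text \<open>Directions steeper than the Lipschitz constant stay strictly above the graph, because
  \<open>\<gamma> 0 = 0\<close> gives
  \<open>\<gamma> (t * s) \<le> L * \<bar>t * s\<bar>\<close>.\<close>

lemma lipschitz_chart_ray:
  assumes chart: "lipschitz_chart \<Omega> p Q \<gamma>"
  obtains L where "0 \<le> L" and
    "\<And>s u. L * \<bar>s\<bar> < u \<Longrightarrow> \<exists>r>0. \<forall>t. 0 < t \<and> t < r \<longrightarrow> p + t *\<^sub>R Q (vector [s, u]) \<in> \<Omega>"
proof -
  from chart obtain r h L where r: "0 < r" and h: "0 < h" and L: "L-lipschitz_on {-r<..<r} \<gamma>"
    and mem: "\<And>s u. \<bar>s\<bar> < r \<Longrightarrow> \<bar>u\<bar> < h \<Longrightarrow> (p + Q (vector [s, u]) \<in> \<Omega> \<longleftrightarrow> \<gamma> s < u)"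
    and Q: "orthogonal_transformation Q" and \<gamma>0: "\<gamma> 0 = 0"
    unfolding lipschitz_chart_def by blast
  have "\<exists>r'>0. \<forall>t. 0 < t \<and> t < r' \<longrightarrow> p + t *\<^sub>R Q (vector [s, u]) \<in> \<Omega>" if su: "L * \<bar>s\<bar> < u" for s u
  proof (intro exI conjI allI impI)
    \<comment> \<open>The summand 1 avoids dividing by zero when a component of the direction
      vanishes.\<close>
    define m where "m = min (r / (1 + \<bar>s\<bar>)) (h / (1 + \<bar>u\<bar>))"
    show "0 < m" using r h by (simp add: m_def)
    fix t assume t: "0 < t \<and> t < m"
    then have "t * (1 + \<bar>s\<bar>) < r" "t * (1 + \<bar>u\<bar>) < h"
      unfolding m_def by (simp_all add: pos_less_divide_eq)
    then have b: "\<bar>t * s\<bar> < r" "\<bar>t * u\<bar> < h"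
      using t by (simp_all add: abs_mult distrib_left)
    have "\<gamma> (t * s) \<le> L * \<bar>t * s\<bar>"
      using lipschitz_onD[OF L, of "t * s" 0] b r \<gamma>0 by (simp add: dist_real_def abs_less_iff)
    also have "\<dots> = t * (L * \<bar>s\<bar>)" using t by (simp add: abs_mult)
    also have "\<dots> < t * u" using su t by simp
    finally have "p + Q (vector [t * s, t * u]) \<in> \<Omega>" using mem b by simp
    moreover have "vector [t * s, t * u] = t *\<^sub>R (vector [s, u] :: real^2)"
      by (simp add: vec_eq_iff forall_2)
    ultimately show "p + t *\<^sub>R Q (vector [s, u]) \<in> \<Omega>"
      using orthogonal_transformation_linear[OF Q] by (simp add: linear_scale)
  qed
  then show ?thesis using that lipschitz_on_nonneg[OF L] by blast
qed

text \<open>At a boundary point the domain contains an open cone of directions, which spans the plane.\<close>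

lemma has_derivative_unique_lipschitz_domain:
  fixes f :: "real^2 \<Rightarrow> 'b::real_normed_vector"
  assumes dom: "lipschitz_domain \<Omega>" and x: "x \<in> closure \<Omega>"
    and f1: "(f has_derivative f1) (at x within closure \<Omega>)"
    and f2: "(f has_derivative f2) (at x within closure \<Omega>)"
  shows "f1 = f2"
proof (cases "x \<in> frontier \<Omega>")
  case False
  then have "x \<in> interior (closure \<Omega>)"
    using x dom unfolding frontier_def lipschitz_domain_def
    by (metis DiffI closure_subset interior_mono interior_open subsetD)
  then have "at x within closure \<Omega> = at x" by (rule at_within_interior)
  then show ?thesis using f1 f2 has_derivative_unique by metis
next
  case True
  with dom obtain Q \<gamma> where chart: "lipschitz_chart \<Omega> x Q \<gamma>"
    unfolding lipschitz_domain_def by blast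
  then have Q: "orthogonal_transformation Q" by (simp add: lipschitz_chart_def)
  then have linQ: "linear Q" by (rule orthogonal_transformation_linear)
  obtain L where L: "0 \<le> L" and cone:
    "\<And>s u. L * \<bar>s\<bar> < u \<Longrightarrow> \<exists>r>0. \<forall>t. 0 < t \<and> t < r \<longrightarrow> x + t *\<^sub>R Q (vector [s, u]) \<in> \<Omega>"
    using lipschitz_chart_ray[OF chart] by blast
  have eq: "f1 (Q (vector [s, u])) = f2 (Q (vector [s, u]))" if su: "L * \<bar>s\<bar> < u" for s u
  proof -
    obtain r where r: "0 < r"
      "\<And>t. 0 < t \<Longrightarrow> t < r \<Longrightarrow> x + t *\<^sub>R Q (vector [s, u]) \<in> \<Omega>"
      using cone[OF su] by blast
    have "x + t *\<^sub>R Q (vector [s, u]) \<in> closure \<Omega>" if "0 \<le> t" "t < r" for t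
      using r(2)[of t] that x closure_subset[of \<Omega>] by (cases "t = 0") auto
    then show ?thesis by (rule has_derivative_ray_unique[OF f1 f2 r(1)])
  qed
  have lin: "linear f1" "linear f2" using f1 f2 by (auto intro: has_derivative_linear)
  show ?thesis
  proof
    fix h
    have "surj Q" using Q by (rule orthogonal_transformation_surj)
    then obtain w where h: "h = Q w" by (metis surjD)
    \<comment> \<open>Both vectors satisfy the cone condition, as \<open>L * 1 < L + 1\<close> and
      \<open>L * 0 < 1\<close>, and together they form a basis.\<close>
    have w: "w = w $ 1 *\<^sub>R vector [1, L + 1] + (w $ 2 - (L + 1) * w $ 1) *\<^sub>R vector [0, 1]"
      by (simp add: vec_eq_iff forall_2 algebra_simps)
    show "f1 h = f2 h"
      unfolding h by (subst (1 2) w)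
        (simp add: linear_add[OF linQ] linear_scale[OF linQ] linear_add[OF lin(1)]
          linear_add[OF lin(2)] linear_scale[OF lin(1)] linear_scale[OF lin(2)] eq L)
  qed
qed

section \<open>Gronwall's inequality\<close>

text \<open>Adding \<open>d / c\<close> makes the inequality homogeneous, and the integrating factor
  then yields a nonincreasing function.\<close>

lemma gronwall_forward:
  fixes u u' :: "real \<Rightarrow> real"
  assumes u: "\<And>s. 0 \<le> s \<Longrightarrow> s \<le> t \<Longrightarrow> (u has_real_derivative u' s) (at s)"
    and le: "\<And>s. 0 \<le> s \<Longrightarrow> s \<le> t \<Longrightarrow> u' s \<le> c * u s + d"
    and c: "0 < c" and t: "0 \<le> t"
  shows "u t \<le> (u 0 + d / c) * exp (c * t) - d / c"
proof -
  let ?w = "\<lambda>s. (u s + d / c) * exp (- (c * s))"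
  have "?w t \<le> ?w 0"
  proof (rule DERIV_nonpos_imp_nonincreasing[OF t])
    fix s assume s: "0 \<le> s" "s \<le> t"
    have "(?w has_real_derivative (u' s - (c * u s + d)) * exp (- (c * s))) (at s)"
      using c by (auto intro!: derivative_eq_intros u s simp: field_simps)
    moreover have "(u' s - (c * u s + d)) * exp (- (c * s)) \<le> 0"
      using le[OF s] by (intro mult_nonpos_nonneg) auto
    ultimately show "\<exists>y. (?w has_real_derivative y) (at s) \<and> y \<le> 0" by blast
  qed
  then show ?thesis by (simp add: exp_minus field_simps)
qed

text \<open>The bound is on the absolute value of \<open>u'\<close>, so that reversing time reduces
  negative t to the forward case.\<close>

lemma gronwall:
  fixes u u' :: "real \<Rightarrow> real"
  assumes u: "\<And>s. \<bar>s\<bar> \<le> \<bar>t\<bar> \<Longrightarrow> (u has_real_derivative u' s) (at s)"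
    and le: "\<And>s. \<bar>s\<bar> \<le> \<bar>t\<bar> \<Longrightarrow> \<bar>u' s\<bar> \<le> c * u s + d"
    and c: "0 < c"
  shows "u t \<le> (u 0 + d / c) * exp (c * \<bar>t\<bar>) - d / c"
proof (cases "0 \<le> t")
  case True
  have "u' s \<le> c * u s + d" if "0 \<le> s" "s \<le> t" for s
    using le[of s] that by simp
  then show ?thesis using gronwall_forward[of t u u' c d] u c True by simp
next
  case False
  have "((\<lambda>s. u (- s)) has_real_derivative - u' (- s)) (at s)" if "0 \<le> s" "s \<le> - t" for s
    using DERIV_chain2[of u "u' (- s)" uminus s "-1" UNIV] u[of "- s"] that
      DERIV_minus[OF DERIV_ident, of s UNIV] by auto
  moreover have "- u' (- s) \<le> c * u (- s) + d" if "0 \<le> s" "s \<le> - t" for s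
    using le[of "- s"] that by simp
  ultimately show ?thesis
    using gronwall_forward[of "- t" "\<lambda>s. u (- s)" "\<lambda>s. - u' (- s)" c d] c False by simp
qed

section \<open>The linearised flow\<close>

lemma has_vector_derivative_chain:
  assumes "(f has_vector_derivative f') (at t)" "(g has_derivative g') (at (f t))"
  shows "((\<lambda>s. g (f s)) has_vector_derivative g' f') (at t)"
  using has_derivative_compose[OF assms(1)[unfolded has_vector_derivative_def] assms(2)]
    has_derivative_linear[OF assms(2)]
  by (simp add: has_vector_derivative_def linear_scale)

lemma has_real_derivative_norm_power2:
  fixes e :: "real \<Rightarrow> 'a::real_inner"
  assumes "(e has_vector_derivative e') (at t)"
  shows "((\<lambda>s. (norm (e s))\<^sup>2) has_real_derivative 2 * (e t \<bullet> e')) (at t)"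
  using bounded_bilinear.has_vector_derivative[OF bounded_bilinear_inner assms assms]
  by (simp add: power2_norm_eq_inner has_real_derivative_iff_has_vector_derivative inner_commute)

text \<open>\<open>D\<close> is the closed domain on which the orbits live. V is differentiable on
  the open set \<open>U\<close> and H on the whole plane, so full derivatives are at hand even at
  boundary points.\<close>

locale planar_flow =
  fixes D U :: "(real^2) set" and V :: "real^2 \<Rightarrow> real^2" and A :: "real^2 \<Rightarrow> (real^2) \<Rightarrow>\<^sub>L (real^2)"
    and H :: "real^2 \<Rightarrow> real" and dH :: "real^2 \<Rightarrow> real^2" and \<Phi> :: "real \<Rightarrow> real^2 \<Rightarrow> real^2"
  assumes compact_D: "compact D" and open_U: "open U" and D_sub: "D \<subseteq> U"
    and V_deriv: "\<And>x. x \<in> U \<Longrightarrow> (V has_derivative A x) (at x)"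
    and A_cont: "continuous_on U A"
    and A_trace: "\<And>x. x \<in> D \<Longrightarrow> trace (matrix (A x)) = 0"
    and H_deriv: "\<And>x. (H has_derivative (\<lambda>h. dH x \<bullet> h)) (at x)"
    and dH_cont: "continuous_on UNIV dH"
    and V_eq: "\<And>x. x \<in> D \<Longrightarrow> V x = - rot (dH x)"
    and flow: "is_flow V D \<Phi>"
begin

lemma flow_0 [simp]: "x \<in> D \<Longrightarrow> \<Phi> 0 x = x"
  and flow_in [simp]: "x \<in> D \<Longrightarrow> \<Phi> t x \<in> D"
  and flow_deriv: "x \<in> D \<Longrightarrow> ((\<lambda>s. \<Phi> s x) has_vector_derivative V (\<Phi> t x)) (at t)"
  using flow by (simp_all add: is_flow_def)

text \<open>A segment between points of \<open>D\<close> may leave \<open>D\<close>. Short ones stay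
  in the closed r-neighbourhood K of \<open>D\<close>, a compact subset of \<open>U\<close> on which
  \<open>A\<close> is uniformly continuous.\<close>

lemma V_uniformly_differentiable:
  assumes "0 < \<epsilon>"
  obtains \<delta> where "0 < \<delta>" and "\<And>x y. x \<in> D \<Longrightarrow> y \<in> D \<Longrightarrow> norm (y - x) < \<delta> \<Longrightarrow>
    norm (V y - V x - A x (y - x)) \<le> \<epsilon> * norm (y - x)"
proof -
  obtain r where r: "0 < r" "(\<Union>x\<in>D. cball x r) \<subseteq> U"
    using compact_subset_open_imp_cball_epsilon_subset[OF compact_D open_U D_sub] .
  define K where "K = {x + y | x y. x \<in> D \<and> y \<in> cball 0 r}"
  have "compact K" unfolding K_def by (intro compact_sums compact_D compact_cball)
  have K: "z \<in> K" if "x \<in> D" "norm (z - x) \<le> r" for x z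
    unfolding K_def using that by (intro CollectI exI[of _ x] exI[of _ "z - x"]) simp
  have KU: "K \<subseteq> U"
  proof
    fix z assume "z \<in> K"
    then obtain x y where "z = x + y" "x \<in> D" "norm y \<le> r" by (auto simp: K_def)
    then have "z \<in> cball x r" by (simp add: dist_norm)
    with \<open>x \<in> D\<close> r(2) show "z \<in> U" by blast
  qed
  have "uniformly_continuous_on K A"
    using \<open>compact K\<close> KU A_cont by (auto intro: compact_uniformly_continuous continuous_on_subset)
  then obtain d where d: "0 < d" "\<And>x z. x \<in> K \<Longrightarrow> z \<in> K \<Longrightarrow> dist z x < d \<Longrightarrow> dist (A z) (A x) < \<epsilon>"
    using assms unfolding uniformly_continuous_on_def by metis
  show ?thesis
  proof
    show "0 < min r d" using r d by simp
    fix x y assume xy: "x \<in> D" "y \<in> D" "norm (y - x) < min r d"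
    let ?S = "ball x (min r d)"
    have S: "z \<in> K" "dist z x < d" if "z \<in> ?S" for z
      using that xy(1) by (auto simp: dist_norm norm_minus_commute intro!: K)
    have "norm (V y - V x - A x (y - x)) \<le> norm (y - x) * \<epsilon>"
    proof (rule differentiable_bound_linearization[where S = ?S and f' = "\<lambda>z. blinfun_apply (A z)"])
      fix t :: real assume "t \<in> {0..1}"
      then have "t * norm (y - x) \<le> 1 * norm (y - x)" by (intro mult_right_mono) auto
      then show "x + t *\<^sub>R (y - x) \<in> ?S" using xy(3) \<open>t \<in> {0..1}\<close> by (simp add: dist_norm)
    next
      fix z assume z: "z \<in> ?S"
      then show "(V has_derivative A z) (at z within ?S)"
        using S KU V_deriv by (blast intro: has_derivative_at_withinI)
      have "x \<in> K" using xy(1) r(1) by (intro K) auto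
      then have "norm (A z - A x) \<le> \<epsilon>" using d(2)[of x z] S[OF z] by (simp add: dist_norm)
      then show "onorm (blinfun_apply (A z) - blinfun_apply (A x)) \<le> \<epsilon>"
        by (simp add: norm_blinfun.rep_eq minus_blinfun.rep_eq fun_diff_def)
    next
      show "x \<in> ?S" using r d by simp
    qed
    then show "norm (V y - V x - A x (y - x)) \<le> \<epsilon> * norm (y - x)" by (simp add: mult.commute)
  qed
qed

lemma V_cont: "continuous_on D V"
  using V_deriv D_sub by (meson has_derivative_continuous continuous_at_imp_continuous_on subsetD)

lemma V_bounded: obtains B where "0 < B" "\<And>x. x \<in> D \<Longrightarrow> norm (V x) \<le> B"
  using compact_imp_bounded[OF compact_continuous_image[OF V_cont compact_D]]
  unfolding bounded_pos by auto

lemma A_bounded: obtains B where "0 < B" "\<And>x. x \<in> D \<Longrightarrow> norm (A x) \<le> B"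
  using compact_imp_bounded[OF compact_continuous_image[OF continuous_on_subset[OF A_cont D_sub] compact_D]]
  unfolding bounded_pos by auto

text \<open>Global in spite of nonconvexity: close pairs are handled by linearisation, and pairs at
  distance at least \<open>\<delta>\<close> by boundedness of V, which produces the summand
  \<open>2 * B / \<delta>\<close>.\<close>

lemma V_lipschitz:
  obtains L where "0 < L" "\<And>x y. x \<in> D \<Longrightarrow> y \<in> D \<Longrightarrow> norm (V y - V x) \<le> L * norm (y - x)"
proof -
  obtain \<delta> where \<delta>: "0 < \<delta>" and lin: "\<And>x y. x \<in> D \<Longrightarrow> y \<in> D \<Longrightarrow> norm (y - x) < \<delta> \<Longrightarrow>
    norm (V y - V x - A x (y - x)) \<le> 1 * norm (y - x)"
    using V_uniformly_differentiable[of 1] by auto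
  obtain B where B: "0 < B" "\<And>x. x \<in> D \<Longrightarrow> norm (V x) \<le> B" using V_bounded by blast
  obtain C where C: "0 < C" "\<And>x. x \<in> D \<Longrightarrow> norm (A x) \<le> C" using A_bounded by blast
  show ?thesis
  proof
    show "0 < 1 + C + 2 * B / \<delta>" using B C \<delta> by (simp add: add_pos_pos)
    fix x y assume xy: "x \<in> D" "y \<in> D"
    show "norm (V y - V x) \<le> (1 + C + 2 * B / \<delta>) * norm (y - x)"
    proof (cases "norm (y - x) < \<delta>")
      case True
      have "norm (A x (y - x)) \<le> C * norm (y - x)"
        using norm_blinfun[of "A x" "y - x"] mult_right_mono[OF C(2)[OF xy(1)], of "norm (y - x)"] by simp
      then have "norm (V y - V x) \<le> (1 + C) * norm (y - x)"
        using lin[OF xy True] norm_triangle_sub[of "V y - V x" "A x (y - x)"] by (simp add: distrib_right)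
      also have "\<dots> \<le> (1 + C + 2 * B / \<delta>) * norm (y - x)"
        using B \<delta> by (intro mult_right_mono) auto
      finally show ?thesis .
    next
      case False
      have "norm (V y - V x) \<le> 2 * B"
        using norm_triangle_ineq4[of "V y" "V x"] B(2)[OF xy(1)] B(2)[OF xy(2)] by simp
      also have "\<dots> \<le> 2 * B / \<delta> * norm (y - x)"
        using False B \<delta> by (simp add: field_simps mult_left_mono)
      also have "\<dots> \<le> (1 + C + 2 * B / \<delta>) * norm (y - x)"
        using C by (intro mult_right_mono) auto
      finally show ?thesis .
    qed
  qed
qed

section \<open>Uniqueness and joint continuity of the flow\<close>

definition solution :: "(real \<Rightarrow> real^2) \<Rightarrow> bool" where
  "solution y \<longleftrightarrow> (\<forall>s. y s \<in> D \<and> (y has_vector_derivative V (y s)) (at s))"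

lemma solution_flow: "x \<in> D \<Longrightarrow> solution (\<lambda>s. \<Phi> s x)"
  by (simp add: solution_def flow_deriv)

lemma solutions_lipschitz:
  obtains L where "0 < L" and "\<And>y z t.
      solution y \<Longrightarrow> solution z \<Longrightarrow>
      norm (y t - z t) \<le> exp (L * \<bar>t\<bar>) * norm (y 0 - z 0)"
proof -
  obtain L where L: "0 < L" and lip: "\<And>x y. x \<in> D \<Longrightarrow> y \<in> D \<Longrightarrow> norm (V y - V x) \<le> L * norm (y - x)"
    using V_lipschitz by blast
  show ?thesis
  proof
    fix y z :: "real \<Rightarrow> real^2" and t :: real
    assume y: "solution y" and z: "solution z"
    let ?e = "\<lambda>s. y s - z s"
    have deriv: "((\<lambda>s. (norm (?e s))\<^sup>2) has_real_derivative 2 * (?e s \<bullet> (V (y s) - V (z s)))) (at s)" for s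
      using y z unfolding solution_def
      by (intro has_real_derivative_norm_power2 has_vector_derivative_diff) auto
    have "\<bar>2 * (?e s \<bullet> (V (y s) - V (z s)))\<bar> \<le> 2 * L * (norm (?e s))\<^sup>2 + 0" for s
    proof -
      have "\<bar>?e s \<bullet> (V (y s) - V (z s))\<bar> \<le> norm (?e s) * norm (V (y s) - V (z s))"
        by (rule Cauchy_Schwarz_ineq2)
      also have "\<dots> \<le> norm (?e s) * (L * norm (?e s))"
        using y z unfolding solution_def by (intro mult_left_mono lip) auto
      finally show ?thesis by (simp add: power2_eq_square abs_mult mult.left_commute)
    qed
    from gronwall[OF deriv this] L
    have "(norm (?e t))\<^sup>2 \<le> (norm (?e 0))\<^sup>2 * exp (2 * L * \<bar>t\<bar>)" by simp
    also have "\<dots> = (exp (L * \<bar>t\<bar>) * norm (?e 0))\<^sup>2"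
      by (simp add: power_mult_distrib mult.commute mult.assoc flip: exp_double)
    finally show "norm (?e t) \<le> exp (L * \<bar>t\<bar>) * norm (?e 0)"
      by (rule power2_le_imp_le) simp
  qed (rule L)
qed

lemma flow_lipschitz:
  obtains L where "0 < L"
    "\<And>x y t. x \<in> D \<Longrightarrow> y \<in> D \<Longrightarrow> norm (\<Phi> t y - \<Phi> t x) \<le> exp (L * \<bar>t\<bar>) * norm (y - x)"
proof -
  obtain L where L: "0 < L" and lip: "\<And>y z t.
      solution y \<Longrightarrow> solution z \<Longrightarrow>
      norm (y t - z t) \<le> exp (L * \<bar>t\<bar>) * norm (y 0 - z 0)"
    using solutions_lipschitz by blast
  show ?thesis
  proof (rule that[OF L])
    fix x y t assume "x \<in> D" "y \<in> D"
    then show "norm (\<Phi> t y - \<Phi> t x) \<le> exp (L * \<bar>t\<bar>) * norm (y - x)"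
      using lip[of "\<lambda>s. \<Phi> s y" "\<lambda>s. \<Phi> s x" t] by (simp add: solution_flow)
  qed
qed

lemma solution_unique:
  assumes y: "solution y"
  shows "y t = \<Phi> t (y 0)"
proof -
  obtain L where "0 < L" and lip: "\<And>y z t.
      solution y \<Longrightarrow> solution z \<Longrightarrow>
      norm (y t - z t) \<le> exp (L * \<bar>t\<bar>) * norm (y 0 - z 0)"
    using solutions_lipschitz by blast
  have "norm (y t - \<Phi> t (y 0)) \<le> exp (L * \<bar>t\<bar>) * norm (y 0 - \<Phi> 0 (y 0))"
    using y by (intro lip solution_flow) (simp_all add: solution_def)
  then show ?thesis using y by (simp add: solution_def)
qed

lemma flow_add:
  assumes "x \<in> D"
  shows "\<Phi> (s + t) x = \<Phi> s (\<Phi> t x)"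
proof -
  have "((\<lambda>s. \<Phi> (s + t) x) has_vector_derivative V (\<Phi> (s + t) x)) (at s)" for s
    using vector_diff_chain_at[of "\<lambda>s. s + t" 1 s "\<lambda>s. \<Phi> s x" "V (\<Phi> (s + t) x)"] flow_deriv[OF assms]
      has_vector_derivative_add[OF has_vector_derivative_id[of "at s"] has_vector_derivative_const[of t]]
    by (simp add: o_def)
  then show ?thesis
    using solution_unique[of "\<lambda>s. \<Phi> (s + t) x" s] assms by (simp add: solution_def)
qed

text \<open>By uniqueness the solution through a zero of V is constant, also backwards in time, so x
  would be that zero.\<close>

lemma V_flow_nonzero:
  assumes x: "x \<in> D" and nz: "V x \<noteq> 0"
  shows "V (\<Phi> t x) \<noteq> 0"
proof
  assume 0: "V (\<Phi> t x) = 0"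
  have "\<Phi> t x = \<Phi> s (\<Phi> t x)" for s
    using solution_unique[of "\<lambda>_. \<Phi> t x" s] x 0 by (simp add: solution_def)
  from this[of "- t"] have "\<Phi> t x = x" using flow_add[OF x, of "- t" t] x by simp
  then show False using 0 nz by simp
qed

lemma flow_zero_constant:
  assumes "x \<in> D" "V x = 0"
  shows "\<Phi> t x = x"
  using solution_unique[of "\<lambda>_. x" t] assms by (simp add: solution_def)

text \<open>Continuity in time at a fixed point combines with a Lipschitz constant in space that is
  locally bounded in time.\<close>

lemma flow_cont: "continuous_on (UNIV \<times> D) (\<lambda>(t, x). \<Phi> t x)"
proof -
  obtain L where L: "0 < L"
    "\<And>x y t. x \<in> D \<Longrightarrow> y \<in> D \<Longrightarrow> norm (\<Phi> t y - \<Phi> t x) \<le> exp (L * \<bar>t\<bar>) * norm (y - x)"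
    using flow_lipschitz by blast
  have "((\<lambda>(t, x). \<Phi> t x) \<longlongrightarrow> \<Phi> s y) (at (s, y) within UNIV \<times> D)" if y: "y \<in> D" for s y
  proof -
    let ?F = "at (s, y) within UNIV \<times> D"
    have fst: "(fst \<longlongrightarrow> s) ?F" and snd: "(snd \<longlongrightarrow> y) ?F"
      by (auto intro!: tendsto_eq_intros tendsto_ident_at)
    have "isCont (\<lambda>t. \<Phi> t y) s"
      using flow_deriv[OF y] by (rule has_vector_derivative_continuous)
    then have "((\<lambda>z. \<Phi> (fst z) y) \<longlongrightarrow> \<Phi> s y) ?F"
      using fst by (rule isCont_tendsto_compose)
    moreover have "((\<lambda>z. \<Phi> (fst z) (snd z) - \<Phi> (fst z) y) \<longlongrightarrow> 0) ?F"
    proof (rule Lim_null_comparison)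
      show "\<forall>\<^sub>F z in ?F. norm (\<Phi> (fst z) (snd z) - \<Phi> (fst z) y) \<le> exp (L * \<bar>fst z\<bar>) * norm (snd z - y)"
        using L(2)[OF y] unfolding eventually_at_filter by (intro always_eventually) auto
      show "((\<lambda>z. exp (L * \<bar>fst z\<bar>) * norm (snd z - y)) \<longlongrightarrow> 0) ?F"
        using fst snd by (auto intro!: tendsto_eq_intros)
    qed
    ultimately have "((\<lambda>z. \<Phi> (fst z) y + (\<Phi> (fst z) (snd z) - \<Phi> (fst z) y)) \<longlongrightarrow> \<Phi> s y + 0) ?F"
      by (rule tendsto_add)
    then show ?thesis by (simp add: case_prod_unfold)
  qed
  then show ?thesis by (auto simp: continuous_on_def)
qed

lemma flow_cont_compose [continuous_intros]:
  "continuous_on S f \<Longrightarrow> continuous_on S g \<Longrightarrow> (\<And>s. s \<in> S \<Longrightarrow> g s \<in> D) \<Longrightarrow>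
    continuous_on S (\<lambda>s. \<Phi> (f s) (g s))"
  by (rule continuous_on_compose2[OF flow_cont, of S "\<lambda>s. (f s, g s)", simplified])
    (auto intro: continuous_on_Pair)

section \<open>The linearised equation along an orbit\<close>

text \<open>The derivative of the coefficient a in the second solution: inserting
  \<open>a *\<^sub>R V + rot V /\<^sub>R (norm V)\<^sup>2\<close> into the linearised equation and
  taking the inner product with V forces this value.\<close>

definition rate :: "real^2 \<Rightarrow> real" where
  "rate z = (V z \<bullet> (A z (rot (V z)) - rot (A z (V z)))) / norm (V z) ^ 4"

text \<open>The second integral makes \<open>shear\<close> an antiderivative for negative times as well; one of the
  two integrals always vanishes.\<close>

definition shear :: "real \<Rightarrow> real^2 \<Rightarrow> real" where
  "shear t x = integral {0..t} (\<lambda>s. rate (\<Phi> s x)) - integral {t..0} (\<lambda>s. rate (\<Phi> s x))"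

lemma rate_cont: "continuous_on {x \<in> D. V x \<noteq> 0} rate"
proof -
  note [continuous_intros] = continuous_on_subset[OF V_cont, of "{x \<in> D. V x \<noteq> 0}"]
    continuous_on_subset[OF A_cont, of "{x \<in> D. V x \<noteq> 0}"]
    bounded_linear.continuous_on[OF bounded_linear_rot]
  show ?thesis unfolding rate_def using D_sub by (intro continuous_intros) auto
qed

text \<open>Near t both integrals are increments of the single antiderivative based at -N, which
  lies to the left of 0 and of t.\<close>

lemma antiderivative_two_sided:
  fixes f :: "real \<Rightarrow> real"
  assumes f: "continuous_on UNIV f"
  shows "((\<lambda>t. integral {0..t} f - integral {t..0} f) has_real_derivative f t) (at t)"
proof -
  define N where "N = \<bar>t\<bar> + 1"
  have N: "0 < N" by (simp add: N_def add_nonneg_pos)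
  have int: "f integrable_on {a..b}" for a b
    using f by (auto intro: integrable_continuous_real continuous_on_subset)
  have "((\<lambda>s. integral {- N..s} f) has_vector_derivative f t) (at t within {-N..N})"
    using f by (intro integral_has_vector_derivative) (auto simp: N_def intro: continuous_on_subset)
  then have "((\<lambda>s. integral {- N..s} f) has_real_derivative f t) (at t within {-N<..<N})"
    by (auto simp: has_real_derivative_iff_has_vector_derivative intro: has_vector_derivative_within_subset)
  then have "((\<lambda>s. integral {- N..s} f) has_real_derivative f t) (at t)"
    using at_within_open[of t "{-N<..<N}"]
    by (simp add: N_def less_diff_eq) (smt (verit))
  then have "((\<lambda>s. integral {- N..s} f - integral {- N..0} f) has_real_derivative f t) (at t)"
    by (auto intro!: derivative_eq_intros)
  then show ?thesis
  proof (rule has_field_derivative_transform_within_open[where S = "{-N<..<N}"])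
    fix s assume s: "s \<in> {-N<..<N}"
    show "integral {- N..s} f - integral {- N..0} f = integral {0..s} f - integral {s..0} f"
    proof (cases "0 \<le> s")
      case True
      then show ?thesis
        using Henstock_Kurzweil_Integration.integral_combine[of "-N" 0 s f] int
N by (cases "s = 0") auto
    next
      case False
      then show ?thesis
        using Henstock_Kurzweil_Integration.integral_combine[of "-N" s 0 f] int s by auto
    qed
  qed (auto simp: N_def)
qed

lemma rate_flow_cont:
  assumes "x \<in> D" "V x \<noteq> 0"
  shows "continuous_on S (\<lambda>s. rate (\<Phi> s x))"
  using assms V_flow_nonzero
  by (intro continuous_on_compose2[OF rate_cont] continuous_intros) auto

lemma shear_deriv:
  assumes "x \<in> D" "V x \<noteq> 0"
  shows "((\<lambda>t. shear t x) has_real_derivative rate (\<Phi> t x)) (at t)"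
  unfolding shear_def by (rule antiderivative_two_sided[OF rate_flow_cont[OF assms]])

lemma shear_0 [simp]: "shear 0 x = 0"
  by (simp add: shear_def)

text \<open>The fundamental matrix: h is expanded in the initial values of the two solutions, and
  the coordinates are kept. The second solution starts at
  \<open>rot (V x) /\<^sub>R (norm (V x))\<^sup>2\<close>, so its coordinate
  \<open>h \<bullet> rot (V x)\<close> carries no denominator.\<close>

definition lin_flow :: "real \<Rightarrow> real^2 \<Rightarrow> real^2 \<Rightarrow> real^2" where
  "lin_flow t x h =
     ((h \<bullet> V x) / (norm (V x))\<^sup>2 + (h \<bullet> rot (V x)) * shear t x) *\<^sub>R V (\<Phi> t x) +
     ((h \<bullet> rot (V x)) / (norm (V (\<Phi> t x)))\<^sup>2) *\<^sub>R rot (V (\<Phi> t x))"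

lemma bounded_linear_lin_flow: "bounded_linear (lin_flow t x)"
  by (rule linear_conv_bounded_linear[THEN iffD1], rule linearI)
    (auto simp: lin_flow_def inner_add_left add_divide_distrib algebra_simps)

lemma lin_flow_0:
  assumes "x \<in> D" "V x \<noteq> 0"
  shows "lin_flow 0 x h = h"
proof -
  have "(norm (V x))\<^sup>2 *\<^sub>R lin_flow 0 x h = (norm (V x))\<^sup>2 *\<^sub>R h"
    unfolding inner_rot_decompose[of "V x" h] using assms by (simp add: lin_flow_def scaleR_add_right)
  then show ?thesis using assms(2) by simp
qed

lemma V_flow_deriv:
  assumes "x \<in> D"
  shows "((\<lambda>t. V (\<Phi> t x)) has_vector_derivative A (\<Phi> t x) (V (\<Phi> t x))) (at t)"
  by (rule has_vector_derivative_chain[OF flow_deriv[OF assms] V_deriv])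
    (use flow_in[OF assms] D_sub in blast)

text \<open>Reduction of order: along an orbit \<open>V\<close> itself solves the linearised equation, and because
  \<open>A\<close> is traceless a second solution is \<open>shear *\<^sub>R V + rot V /\<^sub>R (norm V)\<^sup>2\<close>.\<close>

lemma lin_flow_deriv:
  assumes x: "x \<in> D" and nz: "V x \<noteq> 0"
  shows "((\<lambda>t. lin_flow t x h) has_vector_derivative A (\<Phi> t x) (lin_flow t x h)) (at t)"
proof -
  define q where "q = V (\<Phi> t x)"
  define N where "N = (norm q)\<^sup>2"
  define B where "B = blinfun_apply (A (\<Phi> t x))"
  define c where "c = h \<bullet> rot (V x)"
  define k where "k = (h \<bullet> V x) / (norm (V x))\<^sup>2"
  have N: "N \<noteq> 0" using V_flow_nonzero[OF x nz] by (simp add: N_def q_def)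
  have linB: "linear B" unfolding B_def by (rule bounded_linear.linear[OF blinfun.bounded_linear_right])
  define w where "w = B (rot q) - rot (B q)"
  have rate: "rate (\<Phi> t x) = (q \<bullet> w) / N\<^sup>2"
    by (simp add: rate_def w_def B_def q_def N_def flip: power_mult)
  have dq: "((\<lambda>t. V (\<Phi> t x)) has_vector_derivative B q) (at t)"
    unfolding B_def q_def by (rule V_flow_deriv[OF x])
  have dN: "((\<lambda>t. (norm (V (\<Phi> t x)))\<^sup>2) has_real_derivative 2 * (q \<bullet> B q)) (at t)"
    using has_real_derivative_norm_power2[OF dq] by (simp add: q_def)
  have drot: "((\<lambda>t. rot (V (\<Phi> t x))) has_vector_derivative rot (B q)) (at t)"
    by (rule bounded_linear.has_vector_derivative[OF bounded_linear_rot dq])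
  have dc: "((\<lambda>t. k + c * shear t x) has_real_derivative c * ((q \<bullet> w) / N\<^sup>2)) (at t)"
    using shear_deriv[OF x nz, of t] unfolding rate by (auto intro!: derivative_eq_intros)
  have dn: "((\<lambda>t. c / (norm (V (\<Phi> t x)))\<^sup>2) has_real_derivative - c * (2 * (q \<bullet> B q)) / N\<^sup>2) (at t)"
    using DERIV_divide[OF DERIV_const dN, of c] N by (simp add: N_def q_def power2_eq_square)
  have deriv: "((\<lambda>t. lin_flow t x h) has_vector_derivative
      ((k + c * shear t x) *\<^sub>R B q + (c * ((q \<bullet> w) / N\<^sup>2)) *\<^sub>R q) +
      ((c / N) *\<^sub>R rot (B q) + (- c * (2 * (q \<bullet> B q)) / N\<^sup>2) *\<^sub>R rot q)) (at t)"
    unfolding lin_flow_def k_def[symmetric] c_def[symmetric]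
    using has_vector_derivative_add[OF has_vector_derivative_scaleR[OF dc dq]
        has_vector_derivative_scaleR[OF dn drot]]
    by (simp add: q_def N_def)
  \<comment> \<open>The place where div V = 0 enters: it makes the component of w along
    \<open>rot q\<close> match the derivative of \<open>1 / N\<close>.\<close>
  have "w \<bullet> rot q = - 2 * (q \<bullet> B q)"
  proof -
    have "trace (matrix B) = 0" unfolding B_def using A_trace[OF flow_in[OF x]] .
    then have "rot q \<bullet> B (rot q) + q \<bullet> B q = 0" using rot_inner_trace[OF linB, of q] by simp
    moreover have "w \<bullet> rot q = B (rot q) \<bullet> rot q - B q \<bullet> q" by (simp add: w_def inner_diff_left)
    ultimately show ?thesis by (simp add: inner_commute)
  qed
  then have "N *\<^sub>R w = (q \<bullet> w) *\<^sub>R q - (2 * (q \<bullet> B q)) *\<^sub>R rot q"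
    using inner_rot_decompose[of q w] by (simp add: N_def inner_commute)
  then have "(c / N\<^sup>2) *\<^sub>R (N *\<^sub>R w) = (c / N\<^sup>2) *\<^sub>R ((q \<bullet> w) *\<^sub>R q - (2 * (q \<bullet> B q)) *\<^sub>R rot q)"
    by simp
  then have "(c / N) *\<^sub>R w =
      (c * ((q \<bullet> w) / N\<^sup>2)) *\<^sub>R q + (- c * (2 * (q \<bullet> B q)) / N\<^sup>2) *\<^sub>R rot q"
    using N by (simp add: scaleR_diff_right power2_eq_square)
  moreover have "B (rot q) = w + rot (B q)" by (simp add: w_def)
  ultimately have "(c / N) *\<^sub>R B (rot q) = (c / N) *\<^sub>R rot (B q) + (c * ((q \<bullet> w) / N\<^sup>2)) *\<^sub>R q
      + (- c * (2 * (q \<bullet> B q)) / N\<^sup>2) *\<^sub>R rot q"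
    by (simp add: scaleR_add_right)
  then have "((k + c * shear t x) *\<^sub>R B q + (c * ((q \<bullet> w) / N\<^sup>2)) *\<^sub>R q) +
      ((c / N) *\<^sub>R rot (B q) + (- c * (2 * (q \<bullet> B q)) / N\<^sup>2) *\<^sub>R rot q) = B (lin_flow t x h)"
    unfolding lin_flow_def k_def[symmetric] c_def[symmetric] q_def[symmetric] N_def[symmetric]
    by (simp add: linear_add[OF linB] linear_scale[OF linB] algebra_simps)
  with deriv show ?thesis unfolding B_def by simp
qed

text \<open>The remainder r satisfies r' = A r + E with r(0) = 0, where E is the linearisation error
  of V between two orbits. E is small relative to h, and Gronwall for the squared norm transfers
  this to r.\<close>

lemma flow_has_derivative:
  assumes x: "x \<in> D" and nz: "V x \<noteq> 0"
  shows "(\<Phi> t has_derivative lin_flow t x) (at x within D)"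
  unfolding has_derivative_within_alt
proof (intro conjI allI impI bounded_linear_lin_flow)
  fix e :: real assume e: "0 < e"
  obtain L where L: "0 < L"
    "\<And>x y t. x \<in> D \<Longrightarrow> y \<in> D \<Longrightarrow> norm (\<Phi> t y - \<Phi> t x) \<le> exp (L * \<bar>t\<bar>) * norm (y - x)"
    using flow_lipschitz by blast
  obtain M where M: "0 < M" "\<And>x. x \<in> D \<Longrightarrow> norm (A x) \<le> M" using A_bounded by blast
  \<comment> \<open>\<open>2 * M\<close> bounds the contribution of A to the derivative of the
    squared norm; the 1 comes from splitting \<open>2 * norm (r s) * \<eta>\<close> into
    squares.\<close>
  define c where "c = 2 * M + 1"
  define G where "G = exp (L * \<bar>t\<bar>)"
  \<comment> \<open>Cancels both growth factors: G for the distance of the orbits and the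
    exponential from Gronwall.\<close>
  define \<epsilon> where "\<epsilon> = e / (G * exp (c * \<bar>t\<bar>))"
  have G: "0 < G" by (simp add: G_def)
  have "0 < \<epsilon>" using e G by (simp add: \<epsilon>_def)
  then obtain \<delta> where \<delta>: "0 < \<delta>" and lin: "\<And>x y. x \<in> D \<Longrightarrow> y \<in> D \<Longrightarrow> norm (y - x) < \<delta> \<Longrightarrow>
    norm (V y - V x - A x (y - x)) \<le> \<epsilon> * norm (y - x)"
    using V_uniformly_differentiable by blast
  show "\<exists>d>0. \<forall>y\<in>D. norm (y - x) < d \<longrightarrow>
    norm (\<Phi> t y - \<Phi> t x - lin_flow t x (y - x)) \<le> e * norm (y - x)"
  proof (intro exI conjI ballI impI)
    show "0 < \<delta> / G" using \<delta> G by simp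
    fix y assume y: "y \<in> D" and near: "norm (y - x) < \<delta> / G"
    define h where "h = y - x"
    define r where "r s = \<Phi> s y - \<Phi> s x - lin_flow s x h" for s
    define E where "E s = V (\<Phi> s y) - V (\<Phi> s x) - A (\<Phi> s x) (\<Phi> s y - \<Phi> s x)" for s
    define \<eta> where "\<eta> = \<epsilon> * (G * norm h)"
    have E: "norm (E s) \<le> \<eta>" if "\<bar>s\<bar> \<le> \<bar>t\<bar>" for s
    proof -
      have "exp (L * \<bar>s\<bar>) \<le> G" using that L(1) by (simp add: G_def)
      then have *: "norm (\<Phi> s y - \<Phi> s x) \<le> G * norm h"
        using L(2)[OF x y, of s] mult_right_mono[of _ G "norm h"] unfolding h_def
        by (meson norm_ge_zero order_trans)
      also have "\<dots> < \<delta>" using near G by (simp add: h_def field_simps)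
      finally have "norm (E s) \<le> \<epsilon> * norm (\<Phi> s y - \<Phi> s x)"
        unfolding E_def using x y by (intro lin) auto
      also have "\<dots> \<le> \<eta>" unfolding \<eta>_def using * \<open>0 < \<epsilon>\<close> by (intro mult_left_mono) auto
      finally show ?thesis .
    qed
    have "(r has_vector_derivative V (\<Phi> s y) - V (\<Phi> s x) - A (\<Phi> s x) (lin_flow s x h)) (at s)" for s
      unfolding r_def
      by (intro has_vector_derivative_diff flow_deriv lin_flow_deriv x y nz)
    moreover have "V (\<Phi> s y) - V (\<Phi> s x) - A (\<Phi> s x) (lin_flow s x h) = A (\<Phi> s x) (r s) + E s" for s
      unfolding E_def r_def by (simp add: blinfun.diff_right)
    ultimately have dr: "(r has_vector_derivative A (\<Phi> s x) (r s) + E s) (at s)" for s by simp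
    have "\<bar>2 * (r s \<bullet> (A (\<Phi> s x) (r s) + E s))\<bar> \<le> c * (norm (r s))\<^sup>2 + \<eta>\<^sup>2" if s: "\<bar>s\<bar> \<le> \<bar>t\<bar>" for s
    proof -
      have "norm (A (\<Phi> s x) (r s)) \<le> M * norm (r s)"
        using norm_blinfun[of "A (\<Phi> s x)" "r s"] mult_right_mono[OF M(2)[of "\<Phi> s x"], of "norm (r s)"] x
        by simp
      then have "norm (A (\<Phi> s x) (r s) + E s) \<le> M * norm (r s) + \<eta>"
        using E[OF s] by (meson add_mono norm_triangle_ineq order_trans)
      then have "\<bar>r s \<bullet> (A (\<Phi> s x) (r s) + E s)\<bar> \<le> norm (r s) * (M * norm (r s) + \<eta>)"
        by (meson Cauchy_Schwarz_ineq2 mult_left_mono norm_ge_zero order_trans)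
      moreover have "2 * (norm (r s) * \<eta>) \<le> (norm (r s))\<^sup>2 + \<eta>\<^sup>2"
        using sum_squares_bound[of "norm (r s)" \<eta>] by simp
      ultimately show ?thesis by (simp add: c_def abs_mult power2_eq_square algebra_simps)
    qed
    from gronwall[OF has_real_derivative_norm_power2[OF dr] this]
    have "(norm (r t))\<^sup>2 \<le> ((norm (r 0))\<^sup>2 + \<eta>\<^sup>2 / c) * exp (c * \<bar>t\<bar>) - \<eta>\<^sup>2 / c"
      using M by (simp add: c_def)
    also have "r 0 = 0" using x y nz by (simp add: r_def lin_flow_0 h_def)
    also have "((norm (0::real^2))\<^sup>2 + \<eta>\<^sup>2 / c) * exp (c * \<bar>t\<bar>) - \<eta>\<^sup>2 / c \<le> \<eta>\<^sup>2 / c * exp (c * \<bar>t\<bar>)"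
      using M by (simp add: c_def)
    also have "\<dots> \<le> \<eta>\<^sup>2 * (exp (c * \<bar>t\<bar>))\<^sup>2"
    proof (rule mult_mono)
      show "\<eta>\<^sup>2 / c \<le> \<eta>\<^sup>2" using M by (simp add: c_def divide_le_eq distrib_left)
      show "exp (c * \<bar>t\<bar>) \<le> (exp (c * \<bar>t\<bar>))\<^sup>2" using M by (intro self_le_power) (auto simp: c_def)
    qed auto
    finally have "(norm (r t))\<^sup>2 \<le> (\<eta> * exp (c * \<bar>t\<bar>))\<^sup>2" by (simp add: power_mult_distrib)
    moreover have "0 \<le> \<eta> * exp (c * \<bar>t\<bar>)" using \<open>0 < \<epsilon>\<close> G by (simp add: \<eta>_def)
    ultimately have "norm (r t) \<le> \<eta> * exp (c * \<bar>t\<bar>)" by (rule power2_le_imp_le)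
    also have "\<dots> = e * norm h" using G by (simp add: \<eta>_def \<epsilon>_def)
    finally show "norm (\<Phi> t y - \<Phi> t x - lin_flow t x (y - x)) \<le> e * norm (y - x)"
      unfolding r_def h_def .
  qed
qed

section \<open>The orbit period\<close>

definition periodic :: "(real^2) set" where
  "periodic = {x \<in> D. 0 < orbit_period \<Phi> x \<and> orbit_period \<Phi> x < \<infinity>}"

definition period :: "real^2 \<Rightarrow> real" where
  "period x = real_of_ereal (orbit_period \<Phi> x)"

lemma periodic_in: "x \<in> periodic \<Longrightarrow> x \<in> D"
  by (simp add: periodic_def)

lemma flow_time_cont: "x \<in> D \<Longrightarrow> continuous_on S (\<lambda>t. \<Phi> t x)"
  by (intro continuous_intros) auto

text \<open>The period is only an infimum; it is attained because the times with
  \<open>\<Phi> t x = x\<close> form a closed set.\<close>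

lemma assumes "x \<in> periodic"
  shows period_pos: "0 < period x"
    and flow_period: "\<Phi> (period x) x = x"
    and period_minimal: "\<And>t. 0 < t \<Longrightarrow> t < period x \<Longrightarrow> \<Phi> t x \<noteq> x"
    and periodic_regular: "V x \<noteq> 0"
proof -
  have x: "x \<in> D" using assms by (rule periodic_in)
  define S where "S = {t. 0 < t \<and> \<Phi> t x = x}"
  have op: "orbit_period \<Phi> x = Inf (ereal ` S)" by (simp add: orbit_period_def S_def)
  have "S \<noteq> {}"
  proof
    assume "S = {}"
    then have "orbit_period \<Phi> x = \<infinity>" by (simp add: op top_ereal_def)
    then show False using assms by (simp add: periodic_def)
  qed
  moreover have bdd: "bdd_below S" unfolding S_def by (intro bdd_belowI[of _ 0]) auto
  ultimately have Inf: "orbit_period \<Phi> x = ereal (Inf S)"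
    unfolding op using ereal_Inf'[of S] by simp
  then have per: "period x = Inf S" by (simp add: period_def)
  show pos: "0 < period x" using assms by (simp add: periodic_def Inf per)
  have "closed {t. \<Phi> t x = x}"
    using continuous_closed_vimage[of "{x}" "\<lambda>t. \<Phi> t x"] flow_time_cont[OF x, of UNIV]
    by (simp add: continuous_on_eq_continuous_at vimage_def)
  then have "closure S \<subseteq> {t. \<Phi> t x = x}"
    unfolding S_def by (intro closure_minimal) auto
  moreover have "Inf S \<in> closure S" using \<open>S \<noteq> {}\<close> bdd by (rule closure_contains_Inf)
  ultimately show "\<Phi> (period x) x = x" unfolding per by blast
  show min: "\<Phi> t x \<noteq> x" if "0 < t" "t < period x" for t
    using cInf_lower[OF _ bdd, of t] that unfolding per by (auto simp: S_def)
  show "V x \<noteq> 0"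
    \<comment> \<open>A stationary point would already have returned after half its period.\<close>
    using min[of "period x / 2"] pos flow_zero_constant[OF x] by auto
qed

text \<open>One return bounds the infimum from above; the absence of returns before the positive
  time m keeps it away from 0.\<close>

lemma periodicI:
  assumes x: "x \<in> D" and m: "0 < m" and \<tau>: "0 < \<tau>" "\<Phi> \<tau> x = x"
    and min: "\<And>t. 0 < t \<Longrightarrow> t < m \<Longrightarrow> \<Phi> t x \<noteq> x"
  shows "x \<in> periodic" "m \<le> period x" "period x \<le> \<tau>"
proof -
  have le: "orbit_period \<Phi> x \<le> ereal \<tau>"
    unfolding orbit_period_def using \<tau> by (intro Inf_lower) auto
  have ge: "ereal m \<le> orbit_period \<Phi> x"
    unfolding orbit_period_def
  proof (rule Inf_greatest)
    fix s assume "s \<in> ereal ` {t. 0 < t \<and> \<Phi> t x = x}"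
    then obtain t where "s = ereal t" "0 < t" "\<Phi> t x = x" by auto
    then show "ereal m \<le> s" using min[of t] by (cases "t < m") auto
  qed
  then obtain r where r: "orbit_period \<Phi> x = ereal r"
    using le by (cases "orbit_period \<Phi> x") auto
  show "x \<in> periodic" "m \<le> period x" "period x \<le> \<tau>"
  proof -
    have "m \<le> r" "r \<le> \<tau>" using le ge by (simp_all add: r)
    then show "x \<in> periodic" "m \<le> period x" "period x \<le> \<tau>"
      using m x by (simp_all add: periodic_def period_def r)
  qed
qed

lemma flow_add_period:
  assumes "x \<in> periodic"
  shows "\<Phi> (t + period x) x = \<Phi> t x"
  using flow_add[of x t "period x"] flow_period[OF assms] periodic_in[OF assms] by simp

section \<open>Returns of nearby orbits to a transversal\<close>

lemma H_conserved:
  assumes "x \<in> D"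
  shows "H (\<Phi> t x) = H x"
proof -
  have "((\<lambda>s. H (\<Phi> s x)) has_real_derivative 0) (at s)" for s
    using has_vector_derivative_chain[OF flow_deriv[OF assms] H_deriv, of s] V_eq[OF flow_in[OF assms], of s]
    by (simp add: has_real_derivative_iff_has_vector_derivative)
  then show ?thesis
    using DERIV_isconst_all[of "\<lambda>s. H (\<Phi> s x)" t 0] assms by simp
qed

text \<open>The line orthogonal to \<open>V x\<close> points along the gradient of H at x, so near x
  the slope of H in that direction stays positive. H is defined on the plane, so the segment may
  leave \<open>D\<close>.\<close>

lemma H_injective_transversal:
  assumes x: "x \<in> D" and nz: "V x \<noteq> 0"
  obtains r where "0 < r" and "\<And>y z. norm (y - x) < r \<Longrightarrow> norm (z - x) < r \<Longrightarrow>
    H y = H z \<Longrightarrow> (z - y) \<bullet> V x = 0 \<Longrightarrow> z = y"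
proof -
  define n where "n = rot (V x)"
  have n: "n = dH x" unfolding n_def V_eq[OF x] by (simp add: vec_eq_iff forall_2)
  have "0 < dH x \<bullet> n" using nz unfolding n[symmetric] by (simp add: n_def)
  moreover have "isCont (\<lambda>w. dH w \<bullet> n) x"
    using dH_cont by (intro continuous_intros) (simp add: continuous_on_eq_continuous_at)
  then have "((\<lambda>w. dH w \<bullet> n) \<longlongrightarrow> dH x \<bullet> n) (nhds x)"
    using tendsto_at_iff_tendsto_nhds[of "\<lambda>w. dH w \<bullet> n" x] by (simp add: isCont_def)
  ultimately have "\<forall>\<^sub>F w in nhds x. 0 < dH w \<bullet> n" by (intro order_tendstoD(1))
  then obtain r where r: "0 < r" "\<And>w. dist w x < r \<Longrightarrow> 0 < dH w \<bullet> n"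
    unfolding eventually_nhds_metric by blast
  show ?thesis
  proof (rule that[OF r(1)])
    fix y z assume yz: "norm (y - x) < r" "norm (z - x) < r" "H y = H z" "(z - y) \<bullet> V x = 0"
    define c where "c = ((z - y) \<bullet> n) / (norm (V x))\<^sup>2"
    have zy: "z - y = c *\<^sub>R n"
    proof -
      have "(norm (V x))\<^sup>2 *\<^sub>R (z - y) = (norm (V x))\<^sup>2 *\<^sub>R (c *\<^sub>R n)"
        using inner_rot_decompose[of "V x" "z - y"] yz(4) nz by (simp add: c_def n_def)
      then show ?thesis using nz by (subst (asm) scaleR_cancel_left) simp
    qed
    have "((\<lambda>s. H (y + s *\<^sub>R (z - y))) has_real_derivative dH (y + s *\<^sub>R (z - y)) \<bullet> (z - y)) (at s)" for s
    proof -
      have "((\<lambda>s. y + s *\<^sub>R (z - y)) has_vector_derivative (z - y)) (at s)"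
        by (auto intro!: derivative_eq_intros)
      from has_vector_derivative_chain[OF this H_deriv] show ?thesis
        by (simp add: has_real_derivative_iff_has_vector_derivative)
    qed
    then obtain s where s: "0 < s" "s < 1"
      and eq: "H (y + 1 *\<^sub>R (z - y)) - H (y + 0 *\<^sub>R (z - y)) = (1 - 0) * (dH (y + s *\<^sub>R (z - y)) \<bullet> (z - y))"
      using MVT2[of 0 1 "\<lambda>s. H (y + s *\<^sub>R (z - y))" "\<lambda>s. dH (y + s *\<^sub>R (z - y)) \<bullet> (z - y)"] by auto
    have "y + s *\<^sub>R (z - y) = (1 - s) *\<^sub>R y + s *\<^sub>R z" by (simp add: algebra_simps)
    also have "\<dots> \<in> ball x r"
      using yz s by (intro convexD[OF convex_ball]) (auto simp: dist_norm norm_minus_commute)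
    finally have "0 < dH (y + s *\<^sub>R (z - y)) \<bullet> n" by (intro r) (simp add: dist_commute)
    moreover have "c * (dH (y + s *\<^sub>R (z - y)) \<bullet> n) = 0"
      using eq yz(3) by (simp add: zy[symmetric]) (simp add: zy)
    ultimately have "c = 0" by simp
    then show "z = y" using zy by simp
  qed
qed

lemma continuous_near:
  fixes g :: "real \<Rightarrow> real^2 \<Rightarrow> 'b::topological_space"
  assumes g: "continuous_on (UNIV \<times> D) (\<lambda>(t, x). g t x)" and x: "x \<in> D"
    and W: "open W" "g s x \<in> W"
  obtains \<delta> where "0 < \<delta>"
    "\<And>t y. \<bar>t - s\<bar> \<le> \<delta> \<Longrightarrow> y \<in> D \<Longrightarrow> norm (y - x) \<le> \<delta> \<Longrightarrow> g t y \<in> W"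
proof -
  obtain Z where Z: "open Z" "Z \<inter> (UNIV \<times> D) = (\<lambda>(t, x). g t x) -` W \<inter> (UNIV \<times> D)"
    using continuous_on_open_invariant[THEN iffD1, rule_format, OF g W(1)] by (elim exE conjE) (rule that)
  have "(s, x) \<in> Z \<inter> (UNIV \<times> D)" unfolding Z(2) using x W(2) by simp
  then have "(s, x) \<in> Z" ..
  then obtain e where e: "0 < e" "ball (s, x) e \<subseteq> Z" using Z(1) open_contains_ball by blast
  show ?thesis
  proof
    show "0 < e / 3" using e by simp
    fix t y assume ty: "\<bar>t - s\<bar> \<le> e / 3" "y \<in> D" "norm (y - x) \<le> e / 3"
    have "dist (s, x) (t, y) \<le> \<bar>t - s\<bar> + norm (y - x)"
      unfolding dist_prod_def using sqrt_sum_squares_le_sum_abs[of "dist s t" "dist x y"]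
      by (simp add: dist_norm norm_minus_commute abs_minus_commute)
    then have "(t, y) \<in> Z" using ty e by (intro subsetD[OF e(2)]) auto
    then have "(t, y) \<in> Z \<inter> (UNIV \<times> D)" using ty(2) by simp
    then show "g t y \<in> W" unfolding Z(2) by simp
  qed
qed

lemma V_flow_cont: "continuous_on (UNIV \<times> D) (\<lambda>(t, x). V (\<Phi> t x))"
  using continuous_on_compose2[OF V_cont flow_cont] by (simp add: case_prod_unfold image_subset_iff)

lemma V_flow_inner_cont: "continuous_on (UNIV \<times> D) (\<lambda>(t, x). V (\<Phi> t x) \<bullet> p)"
  using V_flow_cont unfolding case_prod_unfold by (intro continuous_intros)

lemma flow_inner_deriv:
  assumes "y \<in> D"
  shows "((\<lambda>t. (\<Phi> t y - y) \<bullet> p) has_real_derivative V (\<Phi> t y) \<bullet> p) (at t)"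
  unfolding has_real_derivative_iff_has_vector_derivative
  using bounded_linear.has_vector_derivative[OF bounded_linear_inner_left
      has_vector_derivative_diff[OF flow_deriv[OF assms] has_vector_derivative_const]] by simp

lemma flow_inner_increasing:
  assumes "y \<in> D" "a < b" "\<And>t. a \<le> t \<Longrightarrow> t \<le> b \<Longrightarrow> 0 < V (\<Phi> t y) \<bullet> p"
  shows "(\<Phi> a y - y) \<bullet> p < (\<Phi> b y - y) \<bullet> p"
  using assms(2) by (rule DERIV_pos_imp_increasing) (use assms flow_inner_deriv in blast)

text \<open>A nearby orbit comes back to the line through its starting point orthogonal to \<open>V x\<close>;
  conservation of \<open>H\<close> then forces it to return to that very point.\<close>

lemma nearby_return:
  assumes per: "x \<in> periodic" and \<epsilon>: "0 < \<epsilon>"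
  obtains \<delta> where "0 < \<delta>" "\<And>y. y \<in> D \<Longrightarrow> norm (y - x) < \<delta> \<Longrightarrow>
    \<exists>\<tau>. \<bar>\<tau> - period x\<bar> \<le> \<epsilon> \<and> \<Phi> \<tau> y = y"
proof -
  have x: "x \<in> D" using per by (rule periodic_in)
  define T where "T = period x"
  define p where "p = V x"
  have p0: "p \<noteq> 0" using periodic_regular[OF per] by (simp add: p_def)
  have ret: "\<Phi> T x = x" unfolding T_def by (rule flow_period[OF per])
  obtain r where r: "0 < r" and inj: "\<And>y z. norm (y - x) < r \<Longrightarrow> norm (z - x) < r \<Longrightarrow>
    H y = H z \<Longrightarrow> (z - y) \<bullet> p = 0 \<Longrightarrow> z = y"
    using H_injective_transversal[OF x] p0 unfolding p_def by blast
  obtain d1 where d1: "0 < d1"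
    "\<And>t y. \<bar>t - T\<bar> \<le> d1 \<Longrightarrow> y \<in> D \<Longrightarrow> norm (y - x) \<le> d1 \<Longrightarrow> V (\<Phi> t y) \<bullet> p \<in> {0<..}"
    using continuous_near[OF V_flow_inner_cont[of p] x, where W = "{0<..}" and s = T] p0 ret by (auto simp: p_def)
  obtain d2 where d2: "0 < d2"
    "\<And>t y. \<bar>t - T\<bar> \<le> d2 \<Longrightarrow> y \<in> D \<Longrightarrow> norm (y - x) \<le> d2 \<Longrightarrow> \<Phi> t y \<in> ball x r"
    using continuous_near[OF flow_cont x, where W = "ball x r" and s = T] ret r by auto
  \<comment> \<open>Within time d of T the orbit of x advances strictly in direction p and nearby
    orbits stay where H is injective on transversals.\<close>
  define d where "d = Min {d1, d2, \<epsilon>}"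
  have d: "0 < d" "d \<le> d1" "d \<le> d2" "d \<le> \<epsilon>" using d1 d2 \<epsilon> by (auto simp: d_def)
  have inc: "(\<Phi> s x - x) \<bullet> p < (\<Phi> t x - x) \<bullet> p" if "T - d \<le> s" "s < t" "t \<le> T + d" for s t
    using x that(2)
  proof (rule flow_inner_increasing)
    fix w assume "s \<le> w" "w \<le> t"
    then show "0 < V (\<Phi> w x) \<bullet> p" using that d d1(2)[OF _ x, of w] d1(1) by auto
  qed
  \<comment> \<open>Strict signs before and after time T persist for nearby starting points, which
    is what the intermediate value theorem needs.\<close>
  have signs: "(\<Phi> (T - d) x - x) \<bullet> p < 0" "0 < (\<Phi> (T + d) x - x) \<bullet> p"
    using inc[of "T - d" T] inc[of T "T + d"] ret d by auto
  have cont: "continuous_on (UNIV \<times> D) (\<lambda>(t, y). (\<Phi> t y - y) \<bullet> p)"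
    unfolding case_prod_unfold by (intro continuous_intros) auto
  obtain d3 where d3: "0 < d3" "\<And>t y. \<bar>t - (T - d)\<bar> \<le> d3 \<Longrightarrow> y \<in> D \<Longrightarrow> norm (y - x) \<le> d3 \<Longrightarrow>
      (\<Phi> t y - y) \<bullet> p \<in> {..<0}"
    using continuous_near[OF cont x, where W = "{..<0}" and s = "T - d"] signs by auto
  obtain d4 where d4: "0 < d4" "\<And>t y. \<bar>t - (T + d)\<bar> \<le> d4 \<Longrightarrow> y \<in> D \<Longrightarrow> norm (y - x) \<le> d4 \<Longrightarrow>
      (\<Phi> t y - y) \<bullet> p \<in> {0<..}"
    using continuous_near[OF cont x, where W = "{0<..}" and s = "T + d"] signs by auto
  show ?thesis
  proof
    show "0 < Min {d, d3, d4, r}" using d d3 d4 r by simp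
    fix y assume y: "y \<in> D" "norm (y - x) < Min {d, d3, d4, r}"
    have "\<exists>\<tau>\<ge>T - d. \<tau> \<le> T + d \<and> (\<Phi> \<tau> y - y) \<bullet> p = 0"
    proof (rule IVT')
      show "(\<Phi> (T - d) y - y) \<bullet> p \<le> 0" using d3(2)[of "T - d" y] d3(1) y by simp
      show "0 \<le> (\<Phi> (T + d) y - y) \<bullet> p" using d4(2)[of "T + d" y] d4(1) y by simp
      show "T - d \<le> T + d" using d by simp
      show "continuous_on {T - d..T + d} (\<lambda>t. (\<Phi> t y - y) \<bullet> p)"
        using y(1) by (intro continuous_intros) auto
    qed
    then obtain \<tau> where \<tau>: "T - d \<le> \<tau>" "\<tau> \<le> T + d" "(\<Phi> \<tau> y - y) \<bullet> p = 0" by blast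
    have "\<Phi> \<tau> y \<in> ball x r" using \<tau> d d2 y by (intro d2) auto
    then have "\<Phi> \<tau> y = y"
      using y \<tau>(3) H_conserved[OF y(1), of \<tau>]
      by (intro inj) (auto simp: dist_norm norm_minus_commute)
    then show "\<exists>\<tau>. \<bar>\<tau> - period x\<bar> \<le> \<epsilon> \<and> \<Phi> \<tau> y = y"
      using \<tau> d unfolding T_def[symmetric] by (intro exI[of _ \<tau>]) auto
  qed
qed

text \<open>For short times the orbit advances strictly in direction \<open>V x\<close>, uniformly
  near x. The remaining times form a compact interval on which the orbit of x keeps a positive
  distance from x, and nearby orbits inherit this.\<close>

lemma nearby_no_return:
  assumes per: "x \<in> periodic" and m: "m < period x"
  obtains \<delta> where "0 < \<delta>" "\<And>y t. y \<in> D \<Longrightarrow> norm (y - x) < \<delta> \<Longrightarrow> 0 < t \<Longrightarrow> t \<le> m \<Longrightarrow> \<Phi> t y \<noteq> y"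
proof -
  have x: "x \<in> D" using per by (rule periodic_in)
  define p where "p = V x"
  have p0: "p \<noteq> 0" using periodic_regular[OF per] by (simp add: p_def)
  obtain d1 where d1: "0 < d1"
    "\<And>t y. \<bar>t - 0\<bar> \<le> d1 \<Longrightarrow> y \<in> D \<Longrightarrow> norm (y - x) \<le> d1 \<Longrightarrow> V (\<Phi> t y) \<bullet> p \<in> {0<..}"
    using continuous_near[OF V_flow_inner_cont[of p] x, where W = "{0<..}" and s = 0] p0 x by (auto simp: p_def)
  obtain L where L: "0 < L"
    "\<And>x y t. x \<in> D \<Longrightarrow> y \<in> D \<Longrightarrow> norm (\<Phi> t y - \<Phi> t x) \<le> exp (L * \<bar>t\<bar>) * norm (y - x)"
    using flow_lipschitz by blast
  \<comment> \<open>The exponential accounts for the drift between the two orbits, the 1 for the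
    distance of their starting points.\<close>
  define G where "G = exp (L * \<bar>m\<bar>) + 1"
  have G: "0 < G" by (simp add: G_def add_pos_pos)
  have "\<exists>\<mu>>0. \<forall>t\<in>{d1..m}. \<mu> \<le> norm (\<Phi> t x - x)"
  proof (cases "{d1..m} = {}")
    case True
    then show ?thesis by (intro exI[of _ 1]) auto
  next
    case False
    have "continuous_on {d1..m} (\<lambda>t. norm (\<Phi> t x - x))"
      using x by (intro continuous_intros) auto
    then obtain t0 where t0: "t0 \<in> {d1..m}" "\<And>t. t \<in> {d1..m} \<Longrightarrow> norm (\<Phi> t0 x - x) \<le> norm (\<Phi> t x - x)"
      using continuous_attains_inf[of "{d1..m}"] False by (metis compact_Icc)
    have "\<Phi> t0 x \<noteq> x" using period_minimal[OF per, of t0] t0(1) d1(1) m by auto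
    then show ?thesis using t0(2) by (intro exI[of _ "norm (\<Phi> t0 x - x)"]) auto
  qed
  then obtain \<mu> where \<mu>: "0 < \<mu>" "\<And>t. t \<in> {d1..m} \<Longrightarrow> \<mu> \<le> norm (\<Phi> t x - x)" by blast
  show ?thesis
  proof
    show "0 < min d1 (\<mu> / G)" using d1 \<mu> G by simp
    fix y t assume y: "y \<in> D" "norm (y - x) < min d1 (\<mu> / G)" and t: "0 < t" "t \<le> m"
    show "\<Phi> t y \<noteq> y"
    proof (cases "t \<le> d1")
      case True
      have "(\<Phi> 0 y - y) \<bullet> p < (\<Phi> t y - y) \<bullet> p"
        using d1(2)[OF _ y(1)] y(2) t True by (intro flow_inner_increasing y(1)) auto
      then show ?thesis using y(1) by auto
    next
      case False
      have "exp (L * \<bar>t\<bar>) \<le> exp (L * \<bar>m\<bar>)" using L(1) t by simp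
      then have "norm (\<Phi> t y - \<Phi> t x) \<le> exp (L * \<bar>m\<bar>) * norm (y - x)"
        by (intro order_trans[OF L(2)[OF x y(1), of t]] mult_right_mono) auto
      moreover have "norm (\<Phi> t x - x) \<le> norm (\<Phi> t y - \<Phi> t x) + norm (\<Phi> t y - y) + norm (y - x)"
        using norm_triangle_ineq4[of "(\<Phi> t y - y) + (y - x)" "\<Phi> t y - \<Phi> t x"]
          norm_triangle_ineq[of "\<Phi> t y - y" "y - x"] by simp
      moreover have "G * norm (y - x) < \<mu>" using y(2) G by (simp add: field_simps)
      moreover have "\<mu> \<le> norm (\<Phi> t x - x)" using False t by (intro \<mu>(2)) auto
      ultimately have "0 < norm (\<Phi> t y - y)" unfolding G_def distrib_right by linarith
      then show ?thesis by auto
    qed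
  qed
qed

text \<open>Openness of \<open>periodic\<close> and continuity of the period: some return occurs
  close to \<open>period x\<close>, and none earlier than \<open>period x - e\<close>.\<close>

lemma period_near:
  assumes per: "x \<in> periodic" and \<epsilon>: "0 < \<epsilon>"
  obtains \<delta> where "0 < \<delta>"
    "\<And>y. y \<in> D \<Longrightarrow> norm (y - x) < \<delta> \<Longrightarrow> y \<in> periodic \<and> \<bar>period y - period x\<bar> \<le> \<epsilon>"
proof -
  define e where "e = min \<epsilon> (period x / 2)"
  have e: "0 < e" "e \<le> \<epsilon>" "e < period x" using \<epsilon> period_pos[OF per] by (auto simp: e_def)
  obtain d1 where d1: "0 < d1" "\<And>y. y \<in> D \<Longrightarrow> norm (y - x) < d1 \<Longrightarrow>
    \<exists>\<tau>. \<bar>\<tau> - period x\<bar> \<le> e \<and> \<Phi> \<tau> y = y"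
    using nearby_return[OF per e(1)] by blast
  obtain d2 where d2: "0 < d2"
    "\<And>y t. y \<in> D \<Longrightarrow> norm (y - x) < d2 \<Longrightarrow> 0 < t \<Longrightarrow> t \<le> period x - e \<Longrightarrow> \<Phi> t y \<noteq> y"
    using nearby_no_return[OF per, of "period x - e"] e by (metis diff_less_eq less_add_same_cancel1)
  show ?thesis
  proof
    show "0 < min d1 d2" using d1 d2 by simp
    fix y assume y: "y \<in> D" "norm (y - x) < min d1 d2"
    then obtain \<tau> where \<tau>: "\<bar>\<tau> - period x\<bar> \<le> e" "\<Phi> \<tau> y = y" using d1(2)[of y] by auto
    have *: "0 < period x - e" "0 < \<tau>" using e \<tau> by auto
    have "\<Phi> t y \<noteq> y" if "0 < t" "t < period x - e" for t using d2(2)[of y t] y that by auto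
    from periodicI[OF y(1) * \<tau>(2) this]
    show "y \<in> periodic \<and> \<bar>period y - period x\<bar> \<le> \<epsilon>" using \<tau>(1) e by auto
  qed
qed

section \<open>Differentiability of the period\<close>

text \<open>The mean value inequality for the orbit minus uniform motion with velocity p.\<close>

lemma flow_increment_bound:
  assumes y: "y \<in> D" and B: "\<And>s. s \<in> closed_segment a b \<Longrightarrow> norm (V (\<Phi> s y) - p) \<le> B"
  shows "norm (\<Phi> b y - \<Phi> a y - (b - a) *\<^sub>R p) \<le> B * \<bar>b - a\<bar>"
proof -
  let ?g = "\<lambda>s. \<Phi> s y - s *\<^sub>R p"
  have "norm (?g b - ?g a) \<le> B * norm (b - a)"
  proof (rule differentiable_bound[where S = "closed_segment a b"])
    fix s assume s: "s \<in> closed_segment a b"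
    have "(?g has_vector_derivative V (\<Phi> s y) - p) (at s within closed_segment a b)"
      by (intro has_vector_derivative_diff has_vector_derivative_at_within[OF flow_deriv[OF y]])
        (auto intro!: derivative_eq_intros)
    then show "(?g has_derivative (\<lambda>h. h *\<^sub>R (V (\<Phi> s y) - p))) (at s within closed_segment a b)"
      by (simp add: has_vector_derivative_def)
    show "onorm (\<lambda>h. h *\<^sub>R (V (\<Phi> s y) - p)) \<le> B"
      using B[OF s] by (intro onorm_le) (simp add: mult.commute[of B] mult_left_mono)
  qed auto
  then show ?thesis by (simp add: algebra_simps)
qed

text \<open>Differentiate \<open>\<Phi> (period y) y = y\<close>; the derivative of \<open>\<Phi> (period x)\<close> at \<open>x\<close> is the shear
  \<open>h + (h \<bullet> rot (V x)) * shear (period x) x *\<^sub>R V x\<close>.\<close>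

lemma period_has_derivative:
  assumes per: "x \<in> periodic"
  shows "(period has_derivative (\<lambda>h. - shear (period x) x * (h \<bullet> rot (V x)))) (at x within D)"
  unfolding has_derivative_within_alt
proof (intro conjI allI impI)
  show "bounded_linear (\<lambda>h. - shear (period x) x * (h \<bullet> rot (V x)))"
    by (intro bounded_linear_const_mult bounded_linear_inner_left)
  fix e :: real assume e: "0 < e"
  have x: "x \<in> D" using per by (rule periodic_in)
  define T where "T = period x"
  define p where "p = V x"
  define \<beta> where "\<beta> = shear T x"
  have p0: "0 < norm p" using periodic_regular[OF per] by (simp add: p_def)
  have ret: "\<Phi> T x = x" unfolding T_def by (rule flow_period[OF per])
  define K where "K = 1 + \<bar>\<beta>\<bar> * norm p"
  have K: "0 < K" unfolding K_def by (intro add_pos_nonneg) auto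
  \<comment> \<open>The first bound lets the term in \<open>\<bar>a\<bar>\<close> on the right be
    absorbed by the left side; the second leaves half of the allowed error for the rest.\<close>
  define \<epsilon> where "\<epsilon> = min (norm p / 2) (e * norm p / (2 * K))"
  have \<epsilon>: "0 < \<epsilon>" "\<epsilon> \<le> norm p / 2" using e p0 K by (auto simp: \<epsilon>_def)
  have "\<epsilon> \<le> e * norm p / (2 * K)" by (simp add: \<epsilon>_def)
  then have \<epsilon>K: "\<epsilon> * K \<le> e * norm p / 2" using K by (simp add: field_simps)
  have lin: "lin_flow T x h = h + ((h \<bullet> rot p) * \<beta>) *\<^sub>R p" for h
    using lin_flow_0[OF x periodic_regular[OF per], of h] x
    by (simp add: lin_flow_def ret p_def \<beta>_def scaleR_add_left)
  obtain d1 where d1: "0 < d1" "\<And>y. y \<in> D \<Longrightarrow> norm (y - x) < d1 \<Longrightarrow>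
      norm (\<Phi> T y - \<Phi> T x - lin_flow T x (y - x)) \<le> \<epsilon> * norm (y - x)"
    using flow_has_derivative[OF x periodic_regular[OF per], of T] \<epsilon>(1)
    unfolding has_derivative_within_alt by blast
  obtain d2 where d2: "0 < d2"
    "\<And>t y. \<bar>t - T\<bar> \<le> d2 \<Longrightarrow> y \<in> D \<Longrightarrow> norm (y - x) \<le> d2 \<Longrightarrow> V (\<Phi> t y) \<in> ball p \<epsilon>"
    using continuous_near[OF V_flow_cont x, where W = "ball p \<epsilon>" and s = T] \<epsilon>(1) ret by (auto simp: p_def)
  \<comment> \<open>Continuity of the period keeps all times between T and \<open>period y\<close>
    where the velocity is within \<open>\<epsilon>\<close> of p.\<close>
  obtain d3 where d3: "0 < d3"
    "\<And>y. y \<in> D \<Longrightarrow> norm (y - x) < d3 \<Longrightarrow> y \<in> periodic \<and> \<bar>period y - period x\<bar> \<le> d2"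
    using period_near[OF per d2(1)] by blast
  show "\<exists>d>0. \<forall>y\<in>D. norm (y - x) < d \<longrightarrow>
    norm (period y - period x - - shear (period x) x * ((y - x) \<bullet> rot (V x))) \<le> e * norm (y - x)"
  proof (intro exI conjI ballI impI)
    show "0 < Min {d1, d2, d3}" using d1 d2 d3 by simp
    fix y assume y: "y \<in> D" "norm (y - x) < Min {d1, d2, d3}"
    define h where "h = y - x"
    define \<Delta> where "\<Delta> = period y - T"
    define a where "a = \<Delta> + \<beta> * (h \<bullet> rot p)"
    have y_per: "y \<in> periodic" and near: "\<bar>\<Delta>\<bar> \<le> d2"
      using d3(2)[of y] y by (auto simp: \<Delta>_def T_def)
    define E1 where "E1 = \<Phi> T y - \<Phi> T x - lin_flow T x h"
    define E2 where "E2 = \<Phi> (period y) y - \<Phi> T y - \<Delta> *\<^sub>R p"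
    have E1: "norm E1 \<le> \<epsilon> * norm h" unfolding E1_def h_def using y by (intro d1) auto
    have E2: "norm E2 \<le> \<epsilon> * \<bar>\<Delta>\<bar>"
      unfolding E2_def \<Delta>_def
    proof (rule flow_increment_bound[OF y(1)])
      fix s assume s: "s \<in> closed_segment T (period y)"
      then have "\<bar>s - T\<bar> \<le> d2"
        using segment_bound1[OF s] near unfolding \<Delta>_def real_norm_def by linarith
      then show "norm (V (\<Phi> s y) - p) \<le> \<epsilon>"
        using d2(2)[of s y] y by (auto simp: dist_norm norm_minus_commute)
    qed
    \<comment> \<open>Both orbits close up, so the displacement h cancels and only the part along p
      and the two errors remain.\<close>
    have "a *\<^sub>R p = - (E1 + E2)"
      unfolding E1_def E2_def a_def flow_period[OF y_per] ret lin by (simp add: h_def algebra_simps)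
    then have "norm (a *\<^sub>R p) = norm (E1 + E2)" by (simp only: norm_minus_cancel)
    then have "\<bar>a\<bar> * norm p = norm (E1 + E2)" by simp
    then have "\<bar>a\<bar> * norm p \<le> \<epsilon> * norm h + \<epsilon> * \<bar>\<Delta>\<bar>"
      using E1 E2 norm_triangle_ineq[of E1 E2] by linarith
    also have "\<bar>\<Delta>\<bar> \<le> \<bar>a\<bar> + \<bar>\<beta>\<bar> * norm p * norm h"
    proof -
      have "\<bar>\<beta> * (h \<bullet> rot p)\<bar> \<le> \<bar>\<beta>\<bar> * (norm h * norm p)"
        using Cauchy_Schwarz_ineq2[of h "rot p"] by (simp add: abs_mult mult_left_mono)
      then show ?thesis unfolding a_def by (simp add: mult_ac)
    qed
    finally have "\<bar>a\<bar> * norm p \<le> \<epsilon> * norm h + \<epsilon> * (\<bar>a\<bar> + \<bar>\<beta>\<bar> * norm p * norm h)"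
      using \<epsilon>(1) by simp
    also have "\<dots> = \<epsilon> * K * norm h + \<epsilon> * \<bar>a\<bar>" by (simp add: K_def algebra_simps)
    also have "\<dots> \<le> e * norm p / 2 * norm h + norm p / 2 * \<bar>a\<bar>"
      using \<epsilon>K \<epsilon>(2) by (intro add_mono mult_right_mono) auto
    finally have "\<bar>a\<bar> * norm p \<le> (e * norm h) * norm p" by (simp add: field_simps)
    then have "\<bar>a\<bar> \<le> e * norm h" using p0 by simp
    then show "norm (period y - period x - - shear (period x) x * ((y - x) \<bullet> rot (V x))) \<le> e * norm (y - x)"
      by (simp add: a_def \<Delta>_def h_def T_def \<beta>_def p_def)
  qed
qed

end

section \<open>Uniform asymptotics\<close>

lemma periodic_reduce:
  fixes \<phi> :: "real \<Rightarrow> 'a"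
  assumes T: "0 < T" and \<phi>: "\<And>t. \<phi> (t + T) = \<phi> t"
  shows "\<exists>s\<in>{0..T}. \<phi> t = \<phi> s"
proof -
  have shift: "\<phi> (s + of_int n * T) = \<phi> s" for s n
  proof (induction n rule: int_induct[where k = 0])
    case base
    then show ?case by simp
  next
    case (step1 i)
    then show ?case using \<phi>[of "s + of_int i * T"] by (simp add: algebra_simps)
  next
    case (step2 i)
    then show ?case using \<phi>[of "s + of_int (i - 1) * T"] by (simp add: algebra_simps)
  qed
  define n where "n = \<lfloor>t / T\<rfloor>"
  define s where "s = t - of_int n * T"
  have "of_int n \<le> t / T" "t / T \<le> of_int n + 1" unfolding n_def by linarith+
  then have "s \<in> {0..T}" using T by (simp add: s_def field_simps)
  moreover have "\<phi> t = \<phi> s" using shift[of s n] by (simp add: s_def)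
  ultimately show ?thesis by blast
qed

text \<open>The trace of the Gram matrix computed in the orthogonal frame \<open>p\<close>,
  \<open>rot p\<close>.\<close>

lemma frob_rot:
  "(norm p)\<^sup>2 * frob M = (norm (M *v p))\<^sup>2 + (norm (M *v rot p))\<^sup>2"
  unfolding frob_eq power2_norm_eq_inner inner_real2 matrix_vector_mult_def
  by (simp add: sum_2) algebra

text \<open>With q = l P Q |a| the root equation reads 1 - q^2 = l^2 R - l^4, where R is the sum of
  the two squared diagonal entries; this is O(l), hence so is 1 - q, because
  \<open>1 + q \<ge> 1\<close>. Replacing a by its main term m costs at most l P Q C. An error
  proportional to l later decays with l.\<close>

lemma least_sv_asymptotics:
  assumes M: "det M = 1" and P: "c1 \<le> P" "P \<le> c2" and Q: "c1 \<le> Q" "Q \<le> c2" and c1: "0 < c1"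
    and frob: "frob M = (Q / P)\<^sup>2 + (P / Q)\<^sup>2 + (P * Q * a)\<^sup>2"
    and C: "\<bar>a - m\<bar> \<le> C"
  shows "\<bar>least_sv M * (P * Q * \<bar>m\<bar>) - 1\<bar> \<le> least_sv M * (1 + 2 * (c2 / c1)\<^sup>2 + c2\<^sup>2 * C)"
proof -
  define l where "l = least_sv M"
  have l: "0 < l" "l \<le> 1" "l\<^sup>2 * frob M = 1 + l ^ 4"
    unfolding l_def by (rule least_sv[OF M])+
  have pos: "0 < P" "0 < Q" using P Q c1 by auto
  define R where "R = (Q / P)\<^sup>2 + (P / Q)\<^sup>2"
  have "Q / P \<le> c2 / c1" "P / Q \<le> c2 / c1"
    using P Q c1 pos by (intro frac_le; simp)+
  then have "(Q / P)\<^sup>2 \<le> (c2 / c1)\<^sup>2" "(P / Q)\<^sup>2 \<le> (c2 / c1)\<^sup>2"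
    using pos by (intro power_mono; simp)+
  then have R: "0 \<le> R" "R \<le> 2 * (c2 / c1)\<^sup>2" by (simp_all add: R_def)
  define q where "q = l * (P * Q * \<bar>a\<bar>)"
  have q0: "0 \<le> q" using l pos by (simp add: q_def)
  have "q\<^sup>2 = l\<^sup>2 * frob M - l\<^sup>2 * R"
    unfolding frob R_def q_def by (simp add: power_mult_distrib algebra_simps)
  then have q2: "1 - q\<^sup>2 = l\<^sup>2 * R - l ^ 4" using l(3) by simp
  have ll: "l\<^sup>2 \<le> l" using l power_decreasing[of 1 2 l] by simp
  have l4: "l ^ 4 \<le> l" using l power_decreasing[of 1 4 l] by simp
  have "\<bar>1 - q\<bar> * 1 \<le> \<bar>1 - q\<bar> * (1 + q)" using q0 by (intro mult_left_mono) auto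
  also have "\<dots> = \<bar>1 - q\<^sup>2\<bar>"
  proof -
    have "1 - q\<^sup>2 = (1 - q) * (1 + q)" by (simp add: power2_eq_square algebra_simps)
    then show ?thesis using q0 by (simp add: abs_mult)
  qed
  also have "\<dots> \<le> l\<^sup>2 * R + l ^ 4"
  proof -
    have "0 \<le> l\<^sup>2 * R" "0 \<le> l ^ 4" using R(1) l by simp_all
    then show ?thesis unfolding q2 by linarith
  qed
  also have "\<dots> \<le> l * (2 * (c2 / c1)\<^sup>2) + l" using l ll l4 R by (intro add_mono mult_mono) auto
  finally have 1: "\<bar>q - 1\<bar> \<le> l * (1 + 2 * (c2 / c1)\<^sup>2)" by (simp add: algebra_simps)
  have "\<bar>l * (P * Q * \<bar>m\<bar>) - q\<bar> = l * (P * Q * \<bar>\<bar>m\<bar> - \<bar>a\<bar>\<bar>)"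
    using l pos unfolding q_def by (simp add: abs_mult flip: right_diff_distrib)
  also have "\<dots> \<le> l * (c2 * c2 * C)"
    using l pos P Q C by (intro mult_left_mono mult_mono) auto
  finally have "\<bar>l * (P * Q * \<bar>m\<bar>) - q\<bar> \<le> l * (c2\<^sup>2 * C)" by (simp add: power2_eq_square)
  then have "\<bar>l * (P * Q * \<bar>m\<bar>) - 1\<bar> \<le> l * (1 + 2 * (c2 / c1)\<^sup>2) + l * (c2\<^sup>2 * C)"
    using 1 by linarith
  then show ?thesis unfolding l_def by (simp add: distrib_left)
qed

context planar_flow
begin

section \<open>The shear as linear drift plus a periodic deviation\<close>

lemma shear_add_period:
  assumes "x \<in> periodic"
  shows "shear (t + period x) x = shear t x + shear (period x) x"
proof -
  note x = periodic_in[OF assms] and nz = periodic_regular[OF assms]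
  have "((\<lambda>t. shear (t + period x) x - shear t x) has_real_derivative 0) (at t)" for t
    using DERIV_diff[OF DERIV_shift[THEN iffD1, OF shear_deriv[OF x nz, of "t + period x"]] shear_deriv[OF x nz, of t]]
    by (simp add: flow_add_period[OF assms])
  then have "shear (t + period x) x - shear t x = shear (0 + period x) x - shear 0 x"
    using DERIV_isconst_all by blast
  then show ?thesis by simp
qed

text \<open>What is left after the drift is removed is periodic in time, hence controlled by one
  period.\<close>

definition shear_dev :: "real \<Rightarrow> real^2 \<Rightarrow> real" where
  "shear_dev t x = shear t x - t / period x * shear (period x) x"

text \<open>The pair of position and deviation is reduced at once, so that the same s serves
  both.\<close>

lemma orbit_reduce:
  assumes "x \<in> periodic"
  obtains s where "s \<in> {0..period x}" "\<Phi> t x = \<Phi> s x" "shear_dev t x = shear_dev s x"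
proof -
  let ?\<phi> = "\<lambda>t. (\<Phi> t x, shear_dev t x)"
  have "(\<Phi> (t + period x) x, shear_dev (t + period x) x) = (\<Phi> t x, shear_dev t x)" for t
    using period_pos[OF assms]
    by (simp add: shear_dev_def flow_add_period[OF assms] shear_add_period[OF assms] field_simps)
  from periodic_reduce[where \<phi> = ?\<phi>, OF period_pos[OF assms] this, of t] show ?thesis using that by auto
qed

lemma period_cont:
  assumes "K \<subseteq> periodic"
  shows "continuous_on K period"
  unfolding continuous_on_eq_continuous_within
proof
  fix x assume "x \<in> K"
  then have "continuous (at x within D) period"
    using assms period_has_derivative has_derivative_continuous by blast
  then show "continuous (at x within K) period"
    using assms periodic_in by (auto intro: continuous_within_subset)
qed

lemma flow_scaled_cont:
  assumes "K \<subseteq> periodic"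
  shows "continuous_on (K \<times> {0..1}) (\<lambda>(x, s). \<Phi> (s * period x) x)"
  unfolding case_prod_unfold
  using assms periodic_in
  by (intro continuous_intros continuous_on_compose2[OF period_cont[OF assms] continuous_on_fst]) auto

text \<open>Time is measured in periods, so that the union of the orbits is the image of a product
  set although the period varies.\<close>

definition orbits :: "(real^2) set \<Rightarrow> (real^2) set" where
  "orbits K = (\<lambda>(x, s). \<Phi> (s * period x) x) ` (K \<times> {0..1})"

lemma compact_orbits:
  assumes "compact K" "K \<subseteq> periodic"
  shows "compact (orbits K)"
  unfolding orbits_def using assms
  by (intro compact_continuous_image flow_scaled_cont compact_Times) auto

lemma orbits_regular:
  assumes "K \<subseteq> periodic"
  shows "orbits K \<subseteq> {z \<in> D. V z \<noteq> 0}"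
  using assms periodic_in periodic_regular V_flow_nonzero by (auto simp: orbits_def)

lemma flow_in_orbits:
  assumes "x \<in> K" "K \<subseteq> periodic"
  shows "\<Phi> t x \<in> orbits K"
proof -
  have x: "x \<in> periodic" using assms by blast
  obtain s where s: "s \<in> {0..period x}" "\<Phi> t x = \<Phi> s x" using orbit_reduce[OF x] .
  then have "\<Phi> t x = \<Phi> (s / period x * period x) x" "s / period x \<in> {0..1}"
    using period_pos[OF x] by auto
  then show ?thesis unfolding orbits_def using assms(1) by (auto intro!: image_eqI[of _ _ "(x, s / period x)"])
qed

text \<open>The fixed interval of integration makes continuity in x that of a parameter
  integral.\<close>

lemma shear_period_integral:
  assumes "x \<in> periodic"
  shows "shear (period x) x = period x * integral {0..1} (\<lambda>s. rate (\<Phi> (s * period x) x))"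
proof -
  note x = periodic_in[OF assms] and nz = periodic_regular[OF assms]
  have "((\<lambda>s. shear (s * period x) x) has_vector_derivative period x * rate (\<Phi> (s * period x) x)) (at s within {0..1})" for s
    using DERIV_chain2[OF shear_deriv[OF x nz] DERIV_cmult[OF DERIV_ident, of "period x" s "{0..1}"]]
    by (simp add: has_real_derivative_iff_has_vector_derivative[symmetric] mult.commute)
  then have "((\<lambda>s. period x * rate (\<Phi> (s * period x) x)) has_integral
      shear (1 * period x) x - shear (0 * period x) x) {0..1}"
    by (intro fundamental_theorem_of_calculus) auto
  from integral_unique[OF this] show ?thesis by simp
qed

lemma shear_period_cont:
  assumes K: "K \<subseteq> periodic"
  shows "continuous_on K (\<lambda>x. shear (period x) x)"
proof -
  have "continuous_on (K \<times> cbox 0 1) (\<lambda>(x, s). rate (\<Phi> (s * period x) x))"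
    using continuous_on_compose2[OF rate_cont flow_scaled_cont[OF K]] orbits_regular[OF K]
    by (simp add: orbits_def case_prod_unfold)
  then have "continuous_on K (\<lambda>x. period x * integral (cbox 0 1) (\<lambda>s. rate (\<Phi> (s * period x) x)))"
    by (intro continuous_intros period_cont[OF K] integral_continuous_on_param)
  then show ?thesis
    by (rule continuous_on_eq) (use K shear_period_integral in auto)
qed

text \<open>On one period the shear is at most the maximal rate times the longest period, and the
  drift removed there is no larger.\<close>

lemma shear_dev_bounded:
  assumes K: "compact K" "K \<subseteq> periodic"
  obtains C where "\<And>x t. x \<in> K \<Longrightarrow> \<bar>shear_dev t x\<bar> \<le> C"
proof -
  have "compact (rate ` orbits K)"
    using compact_orbits[OF K] orbits_regular[OF K(2)]
    by (intro compact_continuous_image continuous_on_subset[OF rate_cont])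
  then obtain G where G: "0 < G" "\<And>z. z \<in> orbits K \<Longrightarrow> \<bar>rate z\<bar> \<le> G"
    using compact_imp_bounded[THEN bounded_pos[THEN iffD1]] by (metis image_eqI real_norm_def)
  obtain T where T: "0 < T" "\<And>x. x \<in> K \<Longrightarrow> \<bar>period x\<bar> \<le> T"
    using compact_imp_bounded[THEN bounded_pos[THEN iffD1], OF compact_continuous_image[OF period_cont[OF K(2)] K(1)]]
    by (metis image_eqI real_norm_def)
  have sh: "\<bar>shear s x\<bar> \<le> G * T" if x: "x \<in> K" and s: "s \<in> {0..period x}" for s x
  proof -
    have per: "x \<in> periodic" using x K by blast
    have "norm (shear s x - shear 0 x) \<le> G * norm (s - 0)"
    proof (rule field_differentiable_bound[where S = UNIV])
      fix r :: real
      show "((\<lambda>t. shear t x) has_field_derivative rate (\<Phi> r x)) (at r within UNIV)"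
        using shear_deriv[OF periodic_in[OF per] periodic_regular[OF per]] by simp
      show "norm (rate (\<Phi> r x)) \<le> G" using G(2) flow_in_orbits[OF x K(2)] by simp
    qed auto
    also have "\<dots> \<le> G * T" using G T(2)[OF x] s by (intro mult_left_mono) auto
    finally show ?thesis by simp
  qed
  show ?thesis
  proof
    fix x t assume x: "x \<in> K"
    then have per: "x \<in> periodic" using K by blast
    obtain s where s: "s \<in> {0..period x}" "shear_dev t x = shear_dev s x" using orbit_reduce[OF per] .
    have "\<bar>s / period x * shear (period x) x\<bar> \<le> 1 * (G * T)"
      unfolding abs_mult using s period_pos[OF per] sh[OF x, of "period x"]
      by (intro mult_mono) auto
    moreover have "\<bar>shear_dev s x\<bar> \<le> \<bar>shear s x\<bar> + \<bar>s / period x * shear (period x) x\<bar>"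
      unfolding shear_dev_def by (rule abs_triangle_ineq4)
    ultimately have "\<bar>shear_dev s x\<bar> \<le> 2 * (G * T)"
      using sh[OF x s(1)] by linarith
    then show "\<bar>shear_dev t x\<bar> \<le> 2 * (G * T)" unfolding s(2) .
  qed
qed

section \<open>The Jacobian in the orbit frames\<close>

lemma lin_flow_matrix: "matrix (lin_flow t x) *v h = lin_flow t x h"
  using bounded_linear.linear[OF bounded_linear_lin_flow] by simp

lemma assumes "x \<in> D" "V x \<noteq> 0"
  shows lin_flow_V: "lin_flow t x (V x) = V (\<Phi> t x)"
    and lin_flow_rot: "lin_flow t x (rot (V x)) = (norm (V x))\<^sup>2 *\<^sub>R
      (shear t x *\<^sub>R V (\<Phi> t x) + (1 / (norm (V (\<Phi> t x)))\<^sup>2) *\<^sub>R rot (V (\<Phi> t x)))"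
  using assms by (simp_all add: lin_flow_def power2_norm_eq_inner scaleR_add_right)

text \<open>Area spanned by the images of \<open>V x\<close> and \<open>rot (V x)\<close>: the shear
  is along the image of \<open>V x\<close> and drops out.\<close>

lemma det_lin_flow:
  assumes "x \<in> D" "V x \<noteq> 0"
  shows "det (matrix (lin_flow t x)) = 1"
proof -
  have nz: "norm (V (\<Phi> t x)) \<noteq> 0" using V_flow_nonzero[OF assms] by simp
  have "det (matrix (lin_flow t x)) * (rot (V x) \<bullet> rot (V x)) = rot (V x) \<bullet> rot (V x)"
    unfolding rot_inner_matrix[symmetric] lin_flow_matrix lin_flow_V[OF assms] lin_flow_rot[OF assms]
    using nz by (simp add: inner_add_right power2_norm_eq_inner)
  then show ?thesis using assms(2) by simp
qed

text \<open>In the normalised orbit frames the diagonal entries are Q / P and P / Q, and the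
  off-diagonal entry is \<open>P * Q * shear t x\<close>.\<close>

lemma frob_lin_flow:
  fixes t
  assumes "x \<in> D" "V x \<noteq> 0"
  defines "P \<equiv> norm (V x)" and "Q \<equiv> norm (V (\<Phi> t x))"
  shows "frob (matrix (lin_flow t x)) = (Q / P)\<^sup>2 + (P / Q)\<^sup>2 + (P * Q * shear t x)\<^sup>2"
proof -
  have nz: "P \<noteq> 0" "Q \<noteq> 0" using V_flow_nonzero[OF assms(1,2)] assms(2) by (simp_all add: P_def Q_def)
  let ?u = "shear t x *\<^sub>R V (\<Phi> t x)" and ?v = "(1 / Q\<^sup>2) *\<^sub>R rot (V (\<Phi> t x))"
  have "(norm (?u + ?v))\<^sup>2 = (norm ?u)\<^sup>2 + (norm ?v)\<^sup>2"
    by (rule norm_add_Pythagorean) (simp add: orthogonal_def)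
  also have "\<dots> = (shear t x * Q)\<^sup>2 + (1 / Q)\<^sup>2"
    using nz(2) by (simp add: power_mult_distrib power2_eq_square flip: Q_def)
  finally have uv: "(norm (?u + ?v))\<^sup>2 = (shear t x * Q)\<^sup>2 + (1 / Q)\<^sup>2" .
  have "P\<^sup>2 * frob (matrix (lin_flow t x)) = Q\<^sup>2 + (norm (P\<^sup>2 *\<^sub>R (?u + ?v)))\<^sup>2"
    unfolding P_def frob_rot lin_flow_matrix lin_flow_V[OF assms(1,2)] lin_flow_rot[OF assms(1,2)] Q_def ..
  also have "\<dots> = Q\<^sup>2 + (P\<^sup>2)\<^sup>2 * ((shear t x * Q)\<^sup>2 + (1 / Q)\<^sup>2)"
    unfolding uv[symmetric] by (simp add: power_mult_distrib)
  also have "\<dots> = P\<^sup>2 * ((Q / P)\<^sup>2 + (P / Q)\<^sup>2 + (P * Q * shear t x)\<^sup>2)"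
    using nz by (simp add: field_simps power2_eq_square)
  finally show ?thesis using nz(1) by simp
qed

text \<open>The length of grad ln T, read off from \<open>period_has_derivative\<close>.\<close>

definition log_period_slope :: "real^2 \<Rightarrow> real" where
  "log_period_slope x = \<bar>shear (period x) x\<bar> / period x * norm (V x)"

text \<open>All constants are extrema over compact sets: of the speed on the orbits through K, and
  of \<open>\<bar>shear (period x) x\<bar> / period x\<close> on K, where \<open>twist\<close> makes
  the minimum positive.\<close>

lemma uniform_asymptotics:
  assumes K: "compact K" "K \<subseteq> periodic" and twist: "\<And>x. x \<in> K \<Longrightarrow> shear (period x) x \<noteq> 0"
  shows "\<exists>C>0. \<forall>x\<in>K. 0 < log_period_slope x \<and> log_period_slope x \<le> C \<and>
    (\<forall>t. (1 + 1 / norm (V x)) * norm (V (\<Phi> t x)) \<le> C \<and>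
      least_sv (matrix (lin_flow t x)) * (1 + \<bar>t\<bar>) \<le> C \<and>
      \<bar>least_sv (matrix (lin_flow t x)) * (\<bar>t\<bar> * log_period_slope x * norm (V (\<Phi> t x))) - 1\<bar>
        \<le> least_sv (matrix (lin_flow t x)) * C)"
proof (cases "K = {}")
  case True
  then show ?thesis by (intro exI[of _ 1]) simp
next
  case False
  define Z where "Z = orbits K"
  have Z: "compact Z" "Z \<subseteq> {z \<in> D. V z \<noteq> 0}" "Z \<noteq> {}"
    using compact_orbits[OF K] orbits_regular[OF K(2)] False by (auto simp: Z_def orbits_def)
  have KZ: "\<Phi> t x \<in> Z" if "x \<in> K" for t x unfolding Z_def using flow_in_orbits[OF that K(2)] .
  have KZ0: "x \<in> Z" if "x \<in> K" for x using KZ[OF that, of 0] that K(2) periodic_in by auto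
  have "continuous_on Z (\<lambda>z. norm (V z))"
    using Z(2) by (intro continuous_on_norm continuous_on_subset[OF V_cont]) auto
  then obtain z0 where z0: "z0 \<in> Z" "\<And>z. z \<in> Z \<Longrightarrow> norm (V z0) \<le> norm (V z)"
    using continuous_attains_inf[OF Z(1,3)] by blast
  define c1 where "c1 = norm (V z0)"
  have c1: "0 < c1" "\<And>z. z \<in> Z \<Longrightarrow> c1 \<le> norm (V z)" using z0 Z(2) by (auto simp: c1_def)
  obtain c2 where c2: "0 < c2" "\<And>x. x \<in> D \<Longrightarrow> norm (V x) \<le> c2" using V_bounded by blast
  have c2Z: "norm (V z) \<le> c2" if "z \<in> Z" for z using c2(2) Z(2) that by blast
  have twist_cont: "continuous_on K (\<lambda>x. \<bar>shear (period x) x\<bar> / period x)"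
    using period_pos K(2)
    by (intro continuous_intros shear_period_cont[OF K(2)] period_cont[OF K(2)]) force
  obtain x0 where x0: "x0 \<in> K"
    "\<And>x. x \<in> K \<Longrightarrow> \<bar>shear (period x0) x0\<bar> / period x0 \<le> \<bar>shear (period x) x\<bar> / period x"
    using continuous_attains_inf[OF K(1) False twist_cont] by blast
  obtain x1 where x1: "x1 \<in> K"
    "\<And>x. x \<in> K \<Longrightarrow> \<bar>shear (period x) x\<bar> / period x \<le> \<bar>shear (period x1) x1\<bar> / period x1"
    using continuous_attains_sup[OF K(1) False twist_cont] by blast
  define b1 where "b1 = \<bar>shear (period x0) x0\<bar> / period x0"
  define b2 where "b2 = \<bar>shear (period x1) x1\<bar> / period x1"
  have b1: "0 < b1" using twist[OF x0(1)] period_pos[of x0] x0(1) K(2) by (auto simp: b1_def)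
  obtain C0 where C0: "\<And>x t. x \<in> K \<Longrightarrow> \<bar>shear_dev t x\<bar> \<le> C0"
    using shear_dev_bounded[OF K] by blast
  have C0_nonneg: "0 \<le> C0" using C0[OF x0(1), of 0] by linarith
  define B where "B = 1 + 2 * (c2 / c1)\<^sup>2 + c2\<^sup>2 * C0"
  have B: "0 < B" unfolding B_def using C0_nonneg by (intro add_pos_nonneg) auto
  have slope: "0 < log_period_slope x" "log_period_slope x \<le> b2 * c2" "b1 * c1 \<le> log_period_slope x"
    if "x \<in> K" for x
  proof -
    have b: "b1 \<le> \<bar>shear (period x) x\<bar> / period x" "\<bar>shear (period x) x\<bar> / period x \<le> b2"
      using x0(2)[OF that] x1(2)[OF that] by (simp_all add: b1_def b2_def)
    show ge: "b1 * c1 \<le> log_period_slope x"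
      unfolding log_period_slope_def using b b1 c1 KZ0[OF that] by (intro mult_mono) auto
    show "log_period_slope x \<le> b2 * c2"
      unfolding log_period_slope_def using b b1 c2Z KZ0[OF that] by (intro mult_mono) auto
    show "0 < log_period_slope x" using ge b1 c1(1) by (smt (verit) mult_pos_pos)
  qed
  have asymp: "\<bar>least_sv (matrix (lin_flow t x)) *
      (\<bar>t\<bar> * log_period_slope x * norm (V (\<Phi> t x))) - 1\<bar> \<le> least_sv (matrix (lin_flow t x)) * B"
    if x: "x \<in> K" for x t
  proof -
    have per: "x \<in> periodic" using x K(2) by blast
    note reg = periodic_in[OF per] periodic_regular[OF per]
    have "\<bar>shear t x - t / period x * shear (period x) x\<bar> \<le> C0"
      using C0[OF x, of t] by (simp add: shear_dev_def)
    from least_sv_asymptotics[OF det_lin_flow[OF reg] _ _ _ _ c1(1) frob_lin_flow[OF reg] this, of c2]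
    have "\<bar>least_sv (matrix (lin_flow t x)) *
        (norm (V x) * norm (V (\<Phi> t x)) * \<bar>t / period x * shear (period x) x\<bar>) - 1\<bar>
        \<le> least_sv (matrix (lin_flow t x)) * B"
      using c1(2) c2Z KZ[OF x, of t] KZ0[OF x] by (simp add: B_def)
    moreover have "norm (V x) * norm (V (\<Phi> t x)) * \<bar>t / period x * shear (period x) x\<bar>
        = \<bar>t\<bar> * log_period_slope x * norm (V (\<Phi> t x))"
      using period_pos[OF per] by (simp add: log_period_slope_def abs_mult)
    ultimately show ?thesis by (simp only:)
  qed
  \<comment> \<open>The asymptotic estimate bootstraps itself: with the a priori bound
    \<open>l \<le> 1\<close> its error is at most B, which already yields l = O(1 / |t|). The
    leading 1 covers the summand \<open>l * 1\<close>.\<close>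
  have decay: "least_sv (matrix (lin_flow t x)) * (1 + \<bar>t\<bar>) \<le> 1 + (1 + B) / (b1 * c1 * c1)"
    if x: "x \<in> K" for x t
  proof -
    have per: "x \<in> periodic" using x K(2) by blast
    define l where "l = least_sv (matrix (lin_flow t x))"
    have l: "0 < l" "l \<le> 1"
      unfolding l_def using least_sv[OF det_lin_flow[OF periodic_in[OF per] periodic_regular[OF per]]] by auto
    have "b1 * c1 * c1 \<le> log_period_slope x * norm (V (\<Phi> t x))"
      using slope[OF x] c1 KZ[OF x] b1 by (intro mult_mono) auto
    then have "l * \<bar>t\<bar> * (b1 * c1 * c1) \<le> l * \<bar>t\<bar> * (log_period_slope x * norm (V (\<Phi> t x)))"
      using l by (intro mult_left_mono) auto
    also have "\<dots> = l * (\<bar>t\<bar> * log_period_slope x * norm (V (\<Phi> t x)))" by simp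
    also have "\<dots> \<le> 1 + l * B" using asymp[OF x, of t] unfolding l_def[symmetric] by linarith
    also have "\<dots> \<le> 1 + B" using l B by (simp add: mult_left_le_one_le)
    finally have "l * \<bar>t\<bar> \<le> (1 + B) / (b1 * c1 * c1)" using b1 c1(1) by (simp add: pos_le_divide_eq)
    then show ?thesis using l(2) unfolding l_def[symmetric] by (simp add: distrib_left)
  qed
  have speed: "(1 + 1 / norm (V x)) * norm (V (\<Phi> t x)) \<le> (1 + 1 / c1) * c2" if x: "x \<in> K" for x t
    using c1 c2(1) c2Z[OF KZ[OF x]] KZ0[OF x] by (intro mult_mono add_mono frac_le) auto
  let ?C = "Max {B, b2 * c2, (1 + 1 / c1) * c2, 1 + (1 + B) / (b1 * c1 * c1)}"
  show ?thesis
  proof (intro exI[of _ ?C] conjI ballI allI)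
    show "0 < ?C" using B by (simp add: less_max_iff_disj)
    fix x assume x: "x \<in> K"
    show "0 < log_period_slope x" "log_period_slope x \<le> ?C"
      using slope[OF x] by (simp_all add: le_max_iff_disj)
  next
    fix x t assume x: "x \<in> K"
    show "(1 + 1 / norm (V x)) * norm (V (\<Phi> t x)) \<le> ?C"
      using speed[OF x, of t] by (simp add: le_max_iff_disj)
    show "least_sv (matrix (lin_flow t x)) * (1 + \<bar>t\<bar>) \<le> ?C"
      using decay[OF x, of t] by (simp add: le_max_iff_disj)
    have per: "x \<in> periodic" using x K(2) by blast
    have "0 \<le> least_sv (matrix (lin_flow t x))"
      using least_sv_pos[OF det_lin_flow[OF periodic_in[OF per] periodic_regular[OF per]]] by (rule less_imp_le)
    then have "least_sv (matrix (lin_flow t x)) * B \<le> least_sv (matrix (lin_flow t x)) * ?C"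
      by (intro mult_left_mono) auto
    with asymp[OF x, of t]
    show "\<bar>least_sv (matrix (lin_flow t x)) * (\<bar>t\<bar> * log_period_slope x * norm (V (\<Phi> t x))) - 1\<bar>
        \<le> least_sv (matrix (lin_flow t x)) * ?C" by (rule order_trans)
  qed
qed

end

section \<open>Stream functions on Lipschitz domains\<close>

lemma vec2_axis: "(h::real^2) = h $ 1 *\<^sub>R axis 1 1 + h $ 2 *\<^sub>R axis 2 1"
  by (simp add: vec_eq_iff forall_2 axis_def)

lemma grad_inner:
  fixes f :: "real^2 \<Rightarrow> real"
  assumes "(f has_derivative f') (at x)"
  shows "grad f (at x) \<bullet> h = f' h"
proof -
  have f': "frechet_derivative f (at x) = f'" using frechet_derivative_at[OF assms] by simp
  have lin: "linear f'" using assms by (rule has_derivative_linear)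
  have "f' h = f' (h $ 1 *\<^sub>R axis 1 1 + h $ 2 *\<^sub>R axis 2 1)" by (simp flip: vec2_axis)
  also have "\<dots> = h $ 1 * f' (axis 1 1) + h $ 2 * f' (axis 2 1)"
    by (simp add: linear_add[OF lin] linear_scale[OF lin])
  finally show ?thesis by (simp add: grad_def f' inner_real2 mult.commute)
qed

text \<open>The divergence vanishes only in the open set by assumption; continuity of the derivative
  carries this to the boundary.\<close>

lemma planar_flowI:
  assumes domain: "bounded \<Omega>" "lipschitz_domain \<Omega>"
    and field: "admissible_field \<Omega> V"
    and A1: "stream_function \<Omega> V H"
    and flow: "is_flow V (closure \<Omega>) \<Phi>"
  obtains U A where "planar_flow (closure \<Omega>) U V A H (\<lambda>x. grad H (at x)) \<Phi>"
proof -
  from field obtain U A where U: "open U" "closure \<Omega> \<subseteq> U"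
    and A: "\<And>x. x \<in> U \<Longrightarrow> (V has_derivative blinfun_apply (A x)) (at x)" "continuous_on U A"
    and div: "\<And>x. x \<in> \<Omega> \<Longrightarrow> divergence V x = 0"
    unfolding admissible_field_def C1_on_def by blast
  from A1 obtain H' H'' where H: "C2_derivs H H' H'' UNIV"
    and V: "\<And>x. x \<in> closure \<Omega> \<Longrightarrow> V x = vector [grad H (at x) $ 2, - grad H (at x) $ 1]"
    unfolding stream_function_def C2_on_def by blast
  have H': "(H has_derivative blinfun_apply (H' x)) (at x)" for x
    using H by (simp add: C2_derivs_def)
  have "planar_flow (closure \<Omega>) U V A H (\<lambda>x. grad H (at x)) \<Phi>"
  proof
    show "compact (closure \<Omega>)" using domain(1) by (rule compact_closure[THEN iffD2])
    show "open U" "closure \<Omega> \<subseteq> U" "continuous_on U A" "is_flow V (closure \<Omega>) \<Phi>"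
      by (fact U A flow)+
    show "(V has_derivative blinfun_apply (A x)) (at x)" if "x \<in> U" for x by (rule A(1)[OF that])
    show "trace (matrix (blinfun_apply (A x))) = 0" if x: "x \<in> closure \<Omega>" for x
    proof (rule continuous_constant_on_closure[OF _ _ x])
      have "continuous_on (closure \<Omega>) A" using A(2) U(2) by (rule continuous_on_subset)
      then show "continuous_on (closure \<Omega>) (\<lambda>x. trace (matrix (blinfun_apply (A x))))"
        unfolding trace_def matrix_def by (simp add: sum_2) (intro continuous_intros)
      fix y assume y: "y \<in> \<Omega>"
      then have "y \<in> U" using U(2) closure_subset by blast
      then have "frechet_derivative V (at y) = blinfun_apply (A y)"
        using frechet_derivative_at[OF A(1)] by simp
      then show "trace (matrix (blinfun_apply (A y))) = 0"
        using div[OF y] by (simp add: divergence_def jacobian_def)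
    qed
    show "(H has_derivative (\<lambda>h. grad H (at x) \<bullet> h)) (at x)" for x
      using H'[of x] by (simp add: grad_inner[OF H'[of x]])
    have "continuous_on UNIV H'"
      using H unfolding C2_derivs_def
      by (meson UNIV_I continuous_at_imp_continuous_on has_derivative_continuous)
    moreover have "grad H (at x) = (\<chi> i. H' x (axis i 1))" for x
      using frechet_derivative_at[OF H'[of x]] by (simp add: grad_def)
    ultimately show "continuous_on UNIV (\<lambda>x. grad H (at x))"
      by (simp add: continuous_on_vec_lambda blinfun.continuous_on)
    show "V x = - rot (grad H (at x))" if "x \<in> closure \<Omega>" for x
      using V[OF that] by (simp add: vec_eq_iff forall_2)
  qed
  then show ?thesis by (rule that)
qed

section \<open>Transfer to gradients and Jacobians relative to the closed domain\<close>

theorem theorem3p8: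
  fixes \<Omega> :: "(real^2) set" and V :: "real^2 \<Rightarrow> real^2" and H :: "real^2 \<Rightarrow> real"
    and \<Phi> :: "real \<Rightarrow> real^2 \<Rightarrow> real^2" and E :: "(real^2) set"
  assumes domain: "bounded \<Omega>" "lipschitz_domain \<Omega>"
    and field: "admissible_field \<Omega> V"
    and A1: "stream_function \<Omega> V H"
    and A2: "critical_points_condition \<Omega> H"
    and flow: "is_flow V (closure \<Omega>) \<Phi>"
    and E: "E \<noteq> {}" "compact (closure E)" "closure E \<subseteq> shear_set \<Omega> \<Phi>"
  shows "\<exists>lsing :: real \<Rightarrow> real^2 \<Rightarrow> real.
      (\<forall>t. \<forall>x\<in>E. 0 < lsing t x \<and> lsing t x \<le> 1 \<and> 1 \<le> inverse (lsing t x) \<and>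
         has_singular_values (flow_jacobian \<Omega> \<Phi> t x) {# inverse (lsing t x), lsing t x #}) \<and>
      uniform_limit E
        (\<lambda>t x. lsing t x * (t * norm (grad_ln_period \<Omega> \<Phi> x) * norm (V (\<Phi> t x))))
        (\<lambda>x. 1) at_top \<and>
      (\<exists>Vsing :: real \<Rightarrow> real^2 \<Rightarrow> real^2.
         (\<forall>t. \<forall>x\<in>E. right_singular_vector (flow_jacobian \<Omega> \<Phi> t x) (lsing t x) (Vsing t x)) \<and>
         (\<exists>C>0. \<forall>t. \<forall>x\<in>E.
            norm (Vsing t x - V x)
              \<le> C * inverse ((1 + \<bar>t\<bar>) * norm (grad_ln_period \<Omega> \<Phi> x))))"
proof -
  obtain U A where "planar_flow (closure \<Omega>) U V A H (\<lambda>x. grad H (at x)) \<Phi>"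
    using planar_flowI[OF domain field A1 flow] .
  then interpret planar_flow "closure \<Omega>" U V A H "\<lambda>x. grad H (at x)" \<Phi> .
  let ?F = "\<lambda>x. at x within closure \<Omega>"
  \<comment> \<open>\<open>frechet_derivative\<close> chooses some derivative; uniqueness within a
    Lipschitz domain identifies it with any derivative exhibited, also at boundary points.\<close>
  have frechet: "frechet_derivative f (?F x) = f'"
    if "x \<in> closure \<Omega>" "(f has_derivative f') (?F x)"
    for f :: "real^2 \<Rightarrow> 'b::real_normed_vector" and f' x
  proof (rule has_derivative_unique_lipschitz_domain[OF domain(2) that(1) _ that(2)])
    have "f differentiable ?F x" using that(2) unfolding differentiable_def by (intro exI[of _ f'])
    then show "(f has_derivative frechet_derivative f (?F x)) (?F x)"
      unfolding frechet_derivative_works .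
  qed
  have period_eq: "(\<lambda>y. real_of_ereal (orbit_period \<Phi> y)) = period"
    by (simp add: period_def fun_eq_iff)
  have shear_periodic: "shear_set \<Omega> \<Phi> \<subseteq> periodic"
    by (auto simp: shear_set_def periodic_def)
  \<comment> \<open>The gradient of the period is a multiple of \<open>rot (V x)\<close> with factor
    \<open>- shear (period x) x\<close>, so a nonzero gradient forces a nonzero shear.\<close>
  have twist: "shear (period x) x \<noteq> 0" if x: "x \<in> shear_set \<Omega> \<Phi>" for x
  proof
    assume 0: "shear (period x) x = 0"
    have per: "x \<in> periodic" using x shear_periodic by blast
    have "grad period (?F x) = 0"
      unfolding grad_def frechet[OF periodic_in[OF per] period_has_derivative[OF per]]
      by (simp add: 0 vec_eq_iff)
    then show False using x by (simp add: shear_set_def period_eq)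
  qed
  have slope: "norm (grad_ln_period \<Omega> \<Phi> x) = log_period_slope x" if per: "x \<in> periodic" for x
  proof -
    have "((\<lambda>y. ln (period y)) has_derivative
        (\<lambda>h. (- shear (period x) x * (h \<bullet> rot (V x))) * inverse (period x))) (?F x)"
      using has_derivative_ln[OF period_pos[OF per] period_has_derivative[OF per]] by simp
    from frechet[OF periodic_in[OF per] this]
    have "grad_ln_period \<Omega> \<Phi> x = (- shear (period x) x * inverse (period x)) *\<^sub>R rot (V x)"
      unfolding grad_ln_period_def grad_def fun_cong[OF period_eq, unfolded]
      by (simp add: vec_eq_iff forall_2 inner_axis' period_def)
    then show ?thesis
      using period_pos[OF per] by (simp add: log_period_slope_def abs_mult divide_inverse)
  qed
  have jac: "flow_jacobian \<Omega> \<Phi> t x = matrix (lin_flow t x)" if per: "x \<in> periodic" for t x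
    unfolding flow_jacobian_def jacobian_def
    using frechet[OF periodic_in[OF per] flow_has_derivative[OF periodic_in[OF per] periodic_regular[OF per]]]
    by simp
  have K: "closure E \<subseteq> periodic" using E(3) shear_periodic by blast
  then have Ep: "x \<in> periodic" "x \<in> closure E" if "x \<in> E" for x using that closure_subset by blast+
  define l where "l t x = least_sv (matrix (lin_flow t x))" for t x
  have det: "det (matrix (lin_flow t x)) = 1" if "x \<in> E" for t x
    using Ep(1)[OF that] by (intro det_lin_flow periodic_in periodic_regular)
  obtain C where C: "0 < C" and bounds:
    "\<forall>x\<in>closure E. 0 < log_period_slope x \<and> log_period_slope x \<le> C \<and>
      (\<forall>t. (1 + 1 / norm (V x)) * norm (V (\<Phi> t x)) \<le> C \<and> l t x * (1 + \<bar>t\<bar>) \<le> C \<and>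
        \<bar>l t x * (\<bar>t\<bar> * log_period_slope x * norm (V (\<Phi> t x))) - 1\<bar> \<le> l t x * C)"
    using uniform_asymptotics[OF E(2) K] twist E(3) unfolding l_def by blast
  have g: "0 < log_period_slope x" "log_period_slope x \<le> C"
    and speed: "(1 + 1 / norm (V x)) * norm (V (\<Phi> t x)) \<le> C"
    and decay: "l t x * (1 + \<bar>t\<bar>) \<le> C"
    and asymp: "\<bar>l t x * (\<bar>t\<bar> * log_period_slope x * norm (V (\<Phi> t x))) - 1\<bar> \<le> l t x * C"
    if "x \<in> closure E" for t x
    using bspec[OF bounds that] by simp_all
  have l: "0 < l t x" "l t x \<le> 1" "1 \<le> inverse (l t x)" if "x \<in> E" for t x
    unfolding l_def using least_sv[OF det[OF that]] by (simp_all add: one_le_inverse)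
  have near: "\<exists>v. right_singular_vector (matrix (lin_flow t x)) (l t x) v \<and> norm (v - V x) \<le> C * l t x"
    if x: "x \<in> E" for t x
  proof -
    note reg = periodic_in[OF Ep(1)[OF x]] periodic_regular[OF Ep(1)[OF x]]
    obtain v where v: "right_singular_vector (matrix (lin_flow t x)) (l t x) v"
      "norm (v - V x) \<le> (1 + 1 / norm (V x)) * norm (V (\<Phi> t x)) * l t x"
      using singular_vector_near[OF det[OF x] reg(2), of t] unfolding l_def lin_flow_matrix lin_flow_V[OF reg] by blast
    have "(1 + 1 / norm (V x)) * norm (V (\<Phi> t x)) * l t x \<le> C * l t x"
      using speed[OF Ep(2)[OF x]] l(1)[OF x] by (intro mult_right_mono) (auto intro: less_imp_le)
    then show ?thesis using v order_trans by blast
  qed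
  define Vs where "Vs t x = (SOME v. right_singular_vector (matrix (lin_flow t x)) (l t x) v \<and>
    norm (v - V x) \<le> C * l t x)" for t x
  have Vs: "right_singular_vector (matrix (lin_flow t x)) (l t x) (Vs t x)"
    "norm (Vs t x - V x) \<le> C * l t x" if "x \<in> E" for t x
    using someI_ex[OF near[OF that, of t]] unfolding Vs_def by blast+
  show ?thesis
  proof (intro exI[of _ l] conjI exI[of _ Vs] exI[of _ "C * C * C"] allI ballI)
    fix t x assume x: "x \<in> E"
    show "0 < l t x" "l t x \<le> 1" "1 \<le> inverse (l t x)" by (fact l[OF x])+
    show "has_singular_values (flow_jacobian \<Omega> \<Phi> t x) {# inverse (l t x), l t x #}"
      unfolding jac[OF Ep(1)[OF x]] l_def by (rule has_singular_values_unimodular[OF det[OF x]])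
    show "right_singular_vector (flow_jacobian \<Omega> \<Phi> t x) (l t x) (Vs t x)"
      unfolding jac[OF Ep(1)[OF x]] by (rule Vs(1)[OF x])
    let ?g = "log_period_slope x"
    have g': "0 < ?g" "?g \<le> C" by (fact g[OF Ep(2)[OF x]])+
    have "l t x \<le> C / (1 + \<bar>t\<bar>)" using decay[OF Ep(2)[OF x], of t] by (simp add: pos_le_divide_eq)
    \<comment> \<open>The slope is at most C, so dividing by it costs one further factor C. With the
      factor from \<open>decay\<close> and the one from \<open>near\<close> this makes
      \<open>C * C * C\<close>.\<close>
    also have "\<dots> \<le> C * C / ((1 + \<bar>t\<bar>) * ?g)"
      using g' C by (simp add: divide_simps mult_left_mono)
    finally have "C * l t x \<le> C * (C * C / ((1 + \<bar>t\<bar>) * ?g))" using C by (intro mult_left_mono) auto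
    with Vs(2)[OF x, of t] show "norm (Vs t x - V x)
        \<le> C * C * C * inverse ((1 + \<bar>t\<bar>) * norm (grad_ln_period \<Omega> \<Phi> x))"
      unfolding slope[OF Ep(1)[OF x]] by (simp add: divide_inverse mult.assoc)
  next
    show "0 < C * C * C" using C by simp
  next
    show "uniform_limit E
        (\<lambda>t x. l t x * (t * norm (grad_ln_period \<Omega> \<Phi> x) * norm (V (\<Phi> t x)))) (\<lambda>x. 1) at_top"
      unfolding uniform_limit_iff
    proof (intro allI impI)
      fix e :: real assume e: "0 < e"
      show "\<forall>\<^sub>F t in at_top. \<forall>x\<in>E.
          dist (l t x * (t * norm (grad_ln_period \<Omega> \<Phi> x) * norm (V (\<Phi> t x)))) 1 < e"
        \<comment> \<open>Beyond this threshold, which is independent of x, \<open>decay\<close>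
          pushes the error \<open>l t x * C\<close> below e; for nonnegative t the absolute value in
          \<open>asymp\<close> disappears.\<close>
        using eventually_gt_at_top[of "C * C / e"] eventually_ge_at_top[of 0]
      proof (eventually_elim, intro ballI)
        fix t x assume t: "C * C / e < t" "0 \<le> t" and x: "x \<in> E"
        have "l t x * (1 + t) \<le> C" using decay[OF Ep(2)[OF x], of t] t by simp
        then have "l t x * C * (1 + t) \<le> C * C" using C by (simp add: mult.commute mult.left_commute)
        also have "\<dots> < e * (1 + t)" using t e by (simp add: pos_divide_less_eq distrib_left mult.commute)
        finally have "l t x * C < e" using t by simp
        then show "dist (l t x * (t * norm (grad_ln_period \<Omega> \<Phi> x) * norm (V (\<Phi> t x)))) 1 < e"
          using asymp[OF Ep(2)[OF x], of t] t unfolding slope[OF Ep(1)[OF x]] by (simp add: dist_real_def)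
      qed
    qed
  qed
qed

end
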